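(* Let $X(t)$, $a\le t\le b$, be a Yeh process on a probability space $\Omega$ associated with functions $\lambda$ and $\rho$ on $[a,b]$. Then the Wiener integral $I(\cdot)$ with respect to $X$ is a linear mapping from $L^2_{\lambda,\rho}[a,b]$ into $L^2(\Omega)$. Moreover, for all $f,g\in L^2_{\lambda,\rho}[a,b]$: (1) $E[I(f)]=\int_a^b f(t)\,d\lambda(t)$; (2) $E[I(f)I(g)]=\int_a^b f(t)g(t)\,d\rho(t)+\int_a^b f(t)\,d\lambda(t)\int_a^b g(t)\,d\lambda(t)$; (3) $E[(I(f))^2]=\int_a^b f(t)^2\,d\rho(t)+\big(\int_a^b f(t)\,d\lambda(t)\big)^2$; (4) $I(f)$ has the normal distribution $N\big(\int_a^b f(t)\,d\lambda(t),\ \int_a^b f(t)^2\,d\rho(t)\big)$.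
   Context: Fix a finite interval $[a,b]\subset[0,\infty)$. Standing assumptions: $\lambda$ is a continuous real-valued function of bounded variation on $[a,b]$, with total variation function $|\lambda|$; $\rho$ is a continuous monotonically increasing real-valued function on $[a,b]$ whose Lebesgue-Stieltjes measure is equivalent (mutually absolutely continuous) to Lebesgue measure on $[a,b]$. A Yeh process associated with $\lambda,\rho$ is a real-valued stochastic process $X(t)$, $t\in[a,b]$, with (almost surely) continuous sample paths and independent increments such that for all $a\le s<t\le b$, $X(t)-X(s)\sim N(\lambda(t)-\lambda(s),\rho(t)-\rho(s))$, where $N(\mu,\sigma^2)$ is the normal distribution with mean $\mu$ and variance $\sigma^2$ (a point mass at $\mu$ if $\sigma^2=0$). $L^2_\rho[a,b]$ is the Hilbert space of real functions $f$ on $[a,b]$ with $\int_a^b|f|^2\,d\rho<\infty$, with inner product $\langle f,g\rangle_\rho=\int_a^b fg\,d\rho$. $L^2_{\lambda,\rho}[a,b]$ is the Hilbert space of $f\in L^2_\rho[a,b]$ with $\int_a^b|f|^2\,d|\lambda|<\infty$, with inner product $\langle f,g\rangle_{\lambda,\rho}=\int_a^b fg\,d[\rho+|\lambda|]$. Integrals $d\rho,d\lambda,d|\lambda|$ are Lebesgue-Stieltjes integrals. Wiener integral: for a step function $f=\sum_{i=1}^n c_i1_{[t_{i-1},t_i)}$ with $a=t_0<\dots<t_n=b$ and $c_i\in\mathbb R$, set $I(f)=\sum_{i=1}^n c_i(X(t_i)-X(t_{i-1}))$. Step functions are dense in $L^2_{\lambda,\rho}[a,b]$; for $f\in L^2_{\lambda,\rho}[a,b]$,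 $I(f)=\int_a^b f(t)\,dX(t)$ is defined as the $L^2(\Omega)$-limit of $I(f_n)$ for any sequence of step functions $f_n$ converging to $f$ in $L^2_{\lambda,\rho}[a,b]$ (the limit exists and does not depend on the sequence). *)

theory Defs
  imports "HOL-Probability.Probability"
begin

definition is_partition :: "real \<Rightarrow> real \<Rightarrow> nat \<Rightarrow> (nat \<Rightarrow> real) \<Rightarrow> bool" where
  "is_partition a b n t \<longleftrightarrow> t 0 = a \<and> t n = b \<and> (\<forall>i\<in>{1..n}. t (i - 1) < t i)"

definition variation_sums :: "real \<Rightarrow> real \<Rightarrow> (real \<Rightarrow> real) \<Rightarrow> real set" where
  "variation_sums a b F =
     {\<Sum>i=1..n. \<bar>F (t i) - F (t (i - 1))\<bar> | n t. is_partition a b n t}"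

definition bounded_variation_on :: "real \<Rightarrow> real \<Rightarrow> (real \<Rightarrow> real) \<Rightarrow> bool" where
  "bounded_variation_on a b F \<longleftrightarrow> bdd_above (variation_sums a b F)"

definition total_variation :: "real \<Rightarrow> (real \<Rightarrow> real) \<Rightarrow> real \<Rightarrow> real" where
  "total_variation a F t = Sup (variation_sums a t F)"

text \<open>
  Lebesgue-Stieltjes measure on \<open>[a, b]\<close>, for \<open>F\<close> continuous and nondecreasing on \<open>[a, b]\<close>.
  The library measure needs a function on the whole line, so \<open>F\<close> is extended by the
  constants \<open>F a\<close> and \<open>F b\<close>, and the result is restricted to \<open>[a, b]\<close>.
\<close>

definition LS_measure :: "real \<Rightarrow> real \<Rightarrow> (real \<Rightarrow> real) \<Rightarrow> real measure" where
  "LS_measure a b F = restrict_space (interval_measure (\<lambda>x. F (max a (min b x)))) {a..b}"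

text \<open>
  Lebesgue-Stieltjes integral with respect to an integrator \<open>F\<close> of bounded variation, by the
  Jordan decomposition: up to additive constants, which do not affect the measures,
  \<open>(V + F) / 2\<close> and \<open>(V - F) / 2\<close> are the positive and negative variation functions of \<open>F\<close>,
  where \<open>V\<close> is its total variation function.
\<close>

definition LS_integral :: "real \<Rightarrow> real \<Rightarrow> (real \<Rightarrow> real) \<Rightarrow> (real \<Rightarrow> real) \<Rightarrow> real" where
  "LS_integral a b F f =
     (\<integral>x. f x \<partial>LS_measure a b (\<lambda>t. (total_variation a F t + F t) / 2)) -
     (\<integral>x. f x \<partial>LS_measure a b (\<lambda>t. (total_variation a F t - F t) / 2))"

text \<open>
  Elements of \<open>L\<^sup>2\<close> are represented by functions; identification of functions that agree almost
  everywhere is made explicit where it matters.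
\<close>

definition L2 :: "'a measure \<Rightarrow> ('a \<Rightarrow> real) set" where
  "L2 M = {f \<in> borel_measurable M. integrable M (\<lambda>x. (f x)\<^sup>2)}"

definition tendsto_L2 :: "'a measure \<Rightarrow> (nat \<Rightarrow> 'a \<Rightarrow> real) \<Rightarrow> ('a \<Rightarrow> real) \<Rightarrow> bool" where
  "tendsto_L2 M f g \<longleftrightarrow> (\<forall>k. f k \<in> L2 M) \<and> g \<in> L2 M \<and>
     (\<lambda>k. \<integral>x. (f k x - g x)\<^sup>2 \<partial>M) \<longlonglongrightarrow> 0"

definition L2_lam_rho ::
  "real \<Rightarrow> real \<Rightarrow> (real \<Rightarrow> real) \<Rightarrow> (real \<Rightarrow> real) \<Rightarrow> (real \<Rightarrow> real) set" where
  "L2_lam_rho a b lam rho =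
     {f \<in> L2 (LS_measure a b rho).
        integrable (LS_measure a b (total_variation a lam)) (\<lambda>x. (f x)\<^sup>2)}"

definition measure_lam_rho ::
  "real \<Rightarrow> real \<Rightarrow> (real \<Rightarrow> real) \<Rightarrow> (real \<Rightarrow> real) \<Rightarrow> real measure" where
  "measure_lam_rho a b lam rho = LS_measure a b (\<lambda>t. rho t + total_variation a lam t)"

definition normal_law :: "real \<Rightarrow> real \<Rightarrow> real measure" where
  "normal_law \<mu> v =
     (if v = 0 then return borel \<mu> else density lborel (normal_density \<mu> (sqrt v)))"

definition standing_assumptions ::
  "real \<Rightarrow> real \<Rightarrow> (real \<Rightarrow> real) \<Rightarrow> (real \<Rightarrow> real) \<Rightarrow> bool" where
  "standing_assumptions a b lam rho \<longleftrightarrow>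
     0 \<le> a \<and> a < b \<and>
     continuous_on {a..b} lam \<and> bounded_variation_on a b lam \<and>
     continuous_on {a..b} rho \<and> mono_on {a..b} rho \<and>
     absolutely_continuous (LS_measure a b rho) (restrict_space lborel {a..b}) \<and>
     absolutely_continuous (restrict_space lborel {a..b}) (LS_measure a b rho)"

definition yeh_process ::
  "'w measure \<Rightarrow> (real \<Rightarrow> 'w \<Rightarrow> real) \<Rightarrow> real \<Rightarrow> real \<Rightarrow> (real \<Rightarrow> real) \<Rightarrow> (real \<Rightarrow> real) \<Rightarrow> bool" where
  "yeh_process M X a b lam rho \<longleftrightarrow>
     (\<forall>t\<in>{a..b}. X t \<in> borel_measurable M) \<and>
     (AE \<omega> in M. continuous_on {a..b} (\<lambda>t. X t \<omega>)) \<and>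
     (\<forall>c d n t. a \<le> c \<and> d \<le> b \<and> is_partition c d n t \<longrightarrow>
        prob_space.indep_vars M (\<lambda>_. borel) (\<lambda>i \<omega>. X (t i) \<omega> - X (t (i - 1)) \<omega>) {1..n}) \<and>
     (\<forall>s t. a \<le> s \<and> s < t \<and> t \<le> b \<longrightarrow>
        distr M borel (\<lambda>\<omega>. X t \<omega> - X s \<omega>) = normal_law (lam t - lam s) (rho t - rho s))"

definition step_fun :: "nat \<Rightarrow> (nat \<Rightarrow> real) \<Rightarrow> (nat \<Rightarrow> real) \<Rightarrow> real \<Rightarrow> real" where
  "step_fun n t c x = (\<Sum>i=1..n. c i * indicator {t (i - 1)..<t i} x)"

definition step_integral ::
  "(real \<Rightarrow> 'w \<Rightarrow> real) \<Rightarrow> nat \<Rightarrow> (nat \<Rightarrow> real) \<Rightarrow> (nat \<Rightarrow> real) \<Rightarrow> 'w \<Rightarrow> real" where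
  "step_integral X n t c \<omega> = (\<Sum>i=1..n. c i * (X (t i) \<omega> - X (t (i - 1)) \<omega>))"

text \<open>
  The common \<open>L\<^sup>2(M)\<close>-limit of the integrals of all sequences of step functions converging
  to \<open>f\<close>. It is unique only up to almost sure equality; the choice operator picks a representative.
\<close>

definition wiener_integral ::
  "'w measure \<Rightarrow> (real \<Rightarrow> 'w \<Rightarrow> real) \<Rightarrow> real \<Rightarrow> real \<Rightarrow> (real \<Rightarrow> real) \<Rightarrow> (real \<Rightarrow> real) \<Rightarrow>
   (real \<Rightarrow> real) \<Rightarrow> 'w \<Rightarrow> real" where
  "wiener_integral M X a b lam rho f =
     (SOME Y. Y \<in> L2 M \<and>
        (\<forall>n t c. (\<forall>k. is_partition a b (n k) (t k)) \<and>
           tendsto_L2 (measure_lam_rho a b lam rho) (\<lambda>k. step_fun (n k) (t k) (c k)) f \<longrightarrow>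
           tendsto_L2 M (\<lambda>k. step_integral X (n k) (t k) (c k)) Y))"

end

theory Submission
  imports Defs
begin

text \<open>
  Everything is decided on step functions. For a step function \<open>f\<close> the integral \<open>I f\<close> is a linear
  combination of independent normal increments, hence normal with mean \<open>\<integral>f d\<lambda>\<close> and variance
  \<open>\<integral>f\<^sup>2 d\<rho>\<close> (\<open>step_integral_law\<close>). Its second moment is therefore \<open>\<integral>f\<^sup>2 d\<rho> + (\<integral>f d\<lambda>)\<^sup>2\<close>, which by
  Cauchy-Schwarz is at most a constant times \<open>\<integral>f\<^sup>2 d\<nu>\<close>, where \<open>\<nu>\<close> is the measure of \<open>\<rho> + |\<lambda>|\<close>
  (\<open>energy_mean_bound\<close>). So \<open>I\<close> is a bounded linear map on the step functions, which are dense in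
  \<open>L\<^sup>2 \<nu>\<close> (\<open>L2_step_approximable\<close>), and since \<open>L\<^sup>2 M\<close> is complete (\<open>L2_complete\<close>) it extends to a
  bounded linear map on \<open>L\<^sup>2 \<nu>\<close>; the Wiener integral is this extension
  (\<open>wiener_integral_characterization\<close>).

  The normal law survives the passage to the limit: means and variances converge because
  \<open>f \<mapsto> \<integral>f d\<lambda>\<close> and \<open>f \<mapsto> \<integral>f\<^sup>2 d\<rho>\<close> are continuous on \<open>L\<^sup>2 \<nu>\<close>, and the characteristic functions of the
  integrals converge because the integrals do (\<open>tendsto_L2_normal_law\<close>). Working with characteristic
  functions treats the degenerate law, variance \<open>0\<close>, like all others; it occurs when \<open>f\<close> vanishes
  \<open>\<rho>\<close>-almost everywhere, and its mean \<open>\<integral>f d\<lambda>\<close> need not be \<open>0\<close> if \<open>\<lambda>\<close> has a singular part. The first and second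
  moments of \<open>I f\<close> are read off from its law, and the mixed moments follow by polarization.

  The measure theory underneath needs \<open>|\<lambda>|\<close> and the two Jordan components of \<open>\<lambda>\<close> to be continuous
  and increasing, so that they define Lebesgue-Stieltjes measures
  (\<open>continuous_on_total_variation\<close>), and needs these measures to depend additively on the integrator
  (\<open>nn_integral_LS_measure_add\<close>), so that \<open>\<nu>\<close> dominates all of them and \<open>L\<^sup>2 \<nu>\<close> is \<open>L\<^sup>2\<^sub>\<lambda>\<^sub>,\<^sub>\<rho>\<close>.
\<close>

section \<open>Total variation\<close>

lemma is_partition_mono:
  assumes "is_partition a b n t" "i \<le> j" "j \<le> n"
  shows "t i \<le> t j"
  using assms(2,3)
proof (induction j rule: dec_induct)
  case (step m)
  have "t (Suc m - 1) < t (Suc m)"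
    using assms(1) step.prems unfolding is_partition_def by (metis atLeastAtMost_iff le_add1 plus_1_eq_Suc)
  with step show ?case by simp
qed simp

lemma is_partition_strict_mono:
  assumes "is_partition a b n t" "i < j" "j \<le> n"
  shows "t i < t j"
proof -
  have "t i \<le> t (j - 1)" using assms by (intro is_partition_mono[OF assms(1)]) auto
  also have "\<dots> < t j" using assms unfolding is_partition_def by auto
  finally show ?thesis .
qed

lemma is_partition_bounds:
  assumes "is_partition a b n t" "i \<le> n"
  shows "a \<le> t i" "t i \<le> b"
  using is_partition_mono[OF assms(1), of 0 i] is_partition_mono[OF assms(1), of i n] assms
  unfolding is_partition_def by auto

lemma variation_sums_extend:
  assumes "s \<in> variation_sums a x F" "x < y"
  shows "s + \<bar>F y - F x\<bar> \<in> variation_sums a y F"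
proof -
  from assms(1) obtain n t where t: "is_partition a x n t"
    and s: "s = (\<Sum>i=1..n. \<bar>F (t i) - F (t (i - 1))\<bar>)"
    unfolding variation_sums_def by auto
  let ?t = "t(Suc n := y)"
  have partition: "is_partition a y (Suc n) ?t"
    unfolding is_partition_def
  proof (intro conjI ballI)
    fix i assume i: "i \<in> {1..Suc n}"
    show "?t (i - 1) < ?t i"
    proof (cases "i = Suc n")
      case True then show ?thesis using t \<open>x < y\<close> by (simp add: is_partition_def)
    next
      case False
      with i have "i \<in> {1..n}" "i - 1 \<noteq> Suc n" by auto
      then show ?thesis using t False by (simp add: is_partition_def)
    qed
  qed (use t in \<open>simp_all add: is_partition_def\<close>)
  have sum: "(\<Sum>i=1..Suc n. \<bar>F (?t i) - F (?t (i - 1))\<bar>) = s + \<bar>F y - F x\<bar>"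
  proof -
    have "(\<Sum>i=1..n. \<bar>F (?t i) - F (?t (i - 1))\<bar>) = s"
      unfolding s by (intro sum.cong refl arg_cong[where f=abs] arg_cong2[where f=minus]) auto
    moreover have "?t n = x" using t by (simp add: is_partition_def)
    ultimately show ?thesis by simp
  qed
  show ?thesis
    unfolding variation_sums_def
    by (intro CollectI exI[of _ "Suc n"] exI[of _ ?t] conjI partition sum[symmetric])
qed

lemma zero_in_variation_sums: "0 \<in> variation_sums a a F"
proof -
  have "is_partition a a 0 (\<lambda>_. a)" by (simp add: is_partition_def)
  then show ?thesis unfolding variation_sums_def by force
qed

lemma variation_sums_nonempty: "a \<le> x \<Longrightarrow> variation_sums a x F \<noteq> {}"
  using zero_in_variation_sums[of a F] variation_sums_extend[of 0 a a F x]
  by (cases "a = x") auto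

lemma bounded_variation_on_initial:
  assumes "bounded_variation_on a b F" "x \<le> b"
  shows "bdd_above (variation_sums a x F)"
proof (cases "x = b")
  case True then show ?thesis using assms by (simp add: bounded_variation_on_def)
next
  case False
  from assms obtain K where K: "\<And>s. s \<in> variation_sums a b F \<Longrightarrow> s \<le> K"
    unfolding bounded_variation_on_def bdd_above_def by blast
  show ?thesis
  proof (rule bdd_aboveI)
    fix s assume "s \<in> variation_sums a x F"
    then have "s + \<bar>F b - F x\<bar> \<le> K" using False assms by (intro K variation_sums_extend) auto
    then show "s \<le> K" by linarith
  qed
qed

text \<open>
  Append \<open>y\<close> to a partition of \<open>[a, x]\<close>. With both signs of \<open>F y - F x\<close> the
  inequality makes the two Jordan components of \<open>F\<close> increasing.
\<close>

lemma total_variation_increment: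
  assumes bv: "bounded_variation_on a b F" and "a \<le> x" "x \<le> y" "y \<le> b"
  shows "total_variation a F x + \<bar>F y - F x\<bar> \<le> total_variation a F y"
proof (cases "x = y")
  case False
  with assms have "x < y" by simp
  have "Sup (variation_sums a x F) \<le> Sup (variation_sums a y F) - \<bar>F y - F x\<bar>"
  proof (rule cSup_least[OF variation_sums_nonempty[OF \<open>a \<le> x\<close>]])
    fix s assume "s \<in> variation_sums a x F"
    from cSup_upper[OF variation_sums_extend[OF this \<open>x < y\<close>] bounded_variation_on_initial[OF bv \<open>y \<le> b\<close>]]
    show "s \<le> Sup (variation_sums a y F) - \<bar>F y - F x\<bar>" by simp
  qed
  then show ?thesis by (simp add: total_variation_def)
qed simp

lemma total_variation_nonneg:
  assumes "bounded_variation_on a b F" "a \<le> b"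
  shows "0 \<le> total_variation a F a"
  unfolding total_variation_def
  by (intro cSup_upper zero_in_variation_sums bounded_variation_on_initial[OF assms])

text \<open>
  If a partition almost realises the variation of \<open>F\<close> over \<open>[a, b]\<close>, then the variation \<open>W x\<close> of \<open>F\<close>
  along the partition stopped at \<open>x\<close> is close to the total variation uniformly in \<open>x\<close>, because the
  gap between the two grows with \<open>x\<close>. Since \<open>W\<close> inherits the continuity of \<open>F\<close>, so does the total
  variation.
\<close>

lemma continuous_on_total_variation:
  assumes bv: "bounded_variation_on a b F" and cont: "continuous_on {a..b} F" and "a \<le> b"
  shows "continuous_on {a..b} (total_variation a F)"
proof -
  let ?V = "total_variation a F"
  have approx: "\<exists>W. continuous_on {a..b} W \<and> (\<forall>x\<in>{a..b}. \<bar>W x - ?V x\<bar> < e)" if "0 < e" for e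
  proof -
    have "?V b - e < Sup (variation_sums a b F)" using \<open>0 < e\<close> by (simp add: total_variation_def)
    from less_cSupD[OF variation_sums_nonempty[OF \<open>a \<le> b\<close>] this]
    obtain n t where t: "is_partition a b n t"
      and close: "?V b - e < (\<Sum>i=1..n. \<bar>F (t i) - F (t (i - 1))\<bar>)"
      unfolding variation_sums_def by auto
    define W where "W x = (\<Sum>i=1..n. \<bar>F (min x (t i)) - F (min x (t (i - 1)))\<bar>)" for x
    have tb: "a \<le> t i" "t i \<le> b" if "i \<le> n" for i using is_partition_bounds[OF t that] by auto
    have "continuous_on {a..b} (\<lambda>x. F (min x (t i)))" if "i \<le> n" for i
      by (rule continuous_on_compose2[OF cont]) (use tb[OF that] in \<open>auto intro!: continuous_intros\<close>)
    then have contW: "continuous_on {a..b} W"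
      unfolding W_def by (intro continuous_intros) auto
    have clamp: "min a (t i) = a" "min b (t i) = t i" if "i \<le> n" for i
      using tb[OF that] by auto
    have Wb: "W b = (\<Sum>i=1..n. \<bar>F (t i) - F (t (i - 1))\<bar>)" and Wa: "W a = 0"
    proof -
      have "i \<le> n \<and> i - 1 \<le> n" if "i \<in> {1..n}" for i using that by auto
      then show "W b = (\<Sum>i=1..n. \<bar>F (t i) - F (t (i - 1))\<bar>)" "W a = 0"
        unfolding W_def by (auto intro!: sum.cong sum.neutral simp only: clamp abs_zero diff_self)
    qed
    have gap: "W y - W x \<le> ?V y - ?V x" if xy: "a \<le> x" "x \<le> y" "y \<le> b" for x y
    proof -
      define m where "m i = max x (min y (t i))" for i
      \<comment> \<open>stopping at \<open>y\<close> instead of \<open>x\<close> adds the part of the path between \<open>x\<close> and \<open>y\<close>\<close>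
      have split: "F (min y u) - F (min x u) = F (max x (min y u)) - F x" for u
        using xy by (auto simp: min_def max_def)
      have "W y - W x = (\<Sum>i=1..n. \<bar>F (min y (t i)) - F (min y (t (i - 1)))\<bar> -
          \<bar>F (min x (t i)) - F (min x (t (i - 1)))\<bar>)"
        unfolding W_def by (simp add: sum_subtractf)
      also have "\<dots> \<le> (\<Sum>i=1..n. ?V (m i) - ?V (m (i - 1)))"
      proof (rule sum_mono)
        fix i assume i: "i \<in> {1..n}"
        have "t (i - 1) \<le> t i" using i by (intro is_partition_mono[OF t]) auto
        then have "m (i - 1) \<le> m i" by (auto simp: m_def)
        then have "?V (m (i - 1)) + \<bar>F (m i) - F (m (i - 1))\<bar> \<le> ?V (m i)"
          using xy by (intro total_variation_increment[OF bv]) (auto simp: m_def)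
        then have incr: "\<bar>F (m i) - F (m (i - 1))\<bar> \<le> ?V (m i) - ?V (m (i - 1))"
          by (simp only: le_diff_eq add.commute)
        have "F (min y (t i)) - F (min y (t (i - 1))) - (F (min x (t i)) - F (min x (t (i - 1))))
            = (F (min y (t i)) - F (min x (t i))) - (F (min y (t (i - 1))) - F (min x (t (i - 1))))"
          by (simp only: diff_diff_eq2 algebra_simps)
        also have "\<dots> = F (m i) - F (m (i - 1))"
          unfolding split m_def by (simp only: algebra_simps)
        finally show "\<bar>F (min y (t i)) - F (min y (t (i - 1)))\<bar> -
            \<bar>F (min x (t i)) - F (min x (t (i - 1)))\<bar> \<le> ?V (m i) - ?V (m (i - 1))"
          by (metis abs_triangle_ineq2 incr order.trans)
      qed
      also have "\<dots> = ?V (m n) - ?V (m 0)"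
        using sum_telescope''[of 0 n "\<lambda>i. ?V (m i)"] by simp
      also have "\<dots> = ?V y - ?V x"
      proof -
        have "m n = y" "m 0 = x" using t xy by (auto simp: m_def is_partition_def)
        then show ?thesis by simp
      qed
      finally show ?thesis .
    qed
    have "\<bar>W x - ?V x\<bar> < e" if x: "x \<in> {a..b}" for x
    proof -
      have "0 \<le> ?V x - W x"
        using gap[of a x] x Wa total_variation_nonneg[OF bv \<open>a \<le> b\<close>] by auto
      moreover have "?V x - W x < e" using gap[of x b] x Wb close by auto
      ultimately show ?thesis by simp
    qed
    with contW show ?thesis by blast
  qed
  obtain W where W: "\<And>k. continuous_on {a..b} (W k)"
      "\<And>k x. x \<in> {a..b} \<Longrightarrow> \<bar>W k x - ?V x\<bar> < 1 / real (Suc k)"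
    using approx[of "1 / real (Suc k)" for k] by (metis of_nat_0_less_iff zero_less_Suc zero_less_divide_1_iff)
  have "uniform_limit {a..b} W ?V sequentially"
  proof (rule uniform_limitI)
    fix e :: real assume "0 < e"
    have "\<forall>\<^sub>F k in sequentially. 1 / real (Suc k) < e"
      using LIMSEQ_inverse_real_of_nat \<open>0 < e\<close> by (auto simp: tendsto_iff inverse_eq_divide)
    then show "\<forall>\<^sub>F k in sequentially. \<forall>x\<in>{a..b}. dist (W k x) (?V x) < e"
    proof eventually_elim
      case (elim k)
      have "dist (W k x) (?V x) < e" if "x \<in> {a..b}" for x
        using less_trans[OF W(2)[OF that] elim] by (simp add: dist_real_def)
      then show ?case by blast
    qed
  qed
  with W(1) show ?thesis by (intro uniform_limit_theorem) auto
qed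

section \<open>Lebesgue-Stieltjes measures of continuous integrators\<close>

text \<open>
  Continuity excludes atoms, so intervals have the same mass with and without their endpoints.
\<close>

definition LS_integrator :: "real \<Rightarrow> real \<Rightarrow> (real \<Rightarrow> real) \<Rightarrow> bool" where
  "LS_integrator a b F \<longleftrightarrow> a \<le> b \<and> continuous_on {a..b} F \<and> mono_on {a..b} F"

lemma LS_integrator_add:
  "LS_integrator a b F \<Longrightarrow> LS_integrator a b G \<Longrightarrow> LS_integrator a b (\<lambda>t. F t + G t)"
  unfolding LS_integrator_def mono_on_def by (auto intro!: continuous_intros add_mono)

lemma space_LS_measure [simp]: "space (LS_measure a b F) = {a..b}"
  by (simp add: LS_measure_def space_restrict_space)

lemma sets_LS_measure [measurable_cong]:
  "sets (LS_measure a b F) = sets (restrict_space borel {a..b})"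
  unfolding LS_measure_def by (rule sets_restrict_space_cong) simp

lemma emeasure_LS_measure_Icc:
  assumes "LS_integrator a b F" "a \<le> p" "p \<le> q" "q \<le> b"
  shows "emeasure (LS_measure a b F) {p..q} = ennreal (F q - F p)"
proof -
  let ?G = "\<lambda>x. F (max a (min b x))"
  have "continuous_on UNIV ?G"
    by (rule continuous_on_compose2[of "{a..b}" F])
      (use assms in \<open>auto simp: LS_integrator_def intro!: continuous_intros\<close>)
  moreover have "?G x \<le> ?G y" if "x \<le> y" for x y
    using assms(1) that by (auto simp: LS_integrator_def mono_on_def)
  ultimately have "emeasure (interval_measure ?G) {p..q} = ?G q - ?G p"
    by (intro emeasure_interval_measure_Icc[OF \<open>p \<le> q\<close>])
  then show ?thesis
    using assms by (simp add: LS_measure_def emeasure_restrict_space)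
qed

lemma finite_measure_LS_measure: "LS_integrator a b F \<Longrightarrow> finite_measure (LS_measure a b F)"
  using emeasure_LS_measure_Icc[of a b F a b]
  by (intro finite_measureI) (simp add: LS_integrator_def)

lemma measure_LS_measure_Ico:
  assumes F: "LS_integrator a b F" and "a \<le> p" "p \<le> q" "q \<le> b"
  shows "measure (LS_measure a b F) {p..<q} = F q - F p"
proof -
  interpret finite_measure "LS_measure a b F" by (rule finite_measure_LS_measure[OF F])
  have in_sets: "{x..y} \<in> sets (LS_measure a b F)" if "a \<le> x" "y \<le> b" for x y
    using that by (auto simp: sets_LS_measure sets_restrict_space)
  have Icc: "measure (LS_measure a b F) {x..y} = F y - F x" if "a \<le> x" "x \<le> y" "y \<le> b" for x y
    using emeasure_LS_measure_Icc[OF F that] F that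
    by (simp add: measure_def LS_integrator_def mono_on_def)
  have "measure (LS_measure a b F) ({p..q} - {q..q}) = F q - F p"
    using assms by (subst finite_measure_Diff) (auto simp: Icc simp del: atLeastAtMost_singleton intro!: in_sets)
  moreover have "{p..q} - {q..q} = {p..<q}" by auto
  ultimately show ?thesis by simp
qed

text \<open>
  A step function made of cells \<open>[t\<^sub>i\<^sub>-\<^sub>1, t\<^sub>i)\<close> always vanishes at \<open>b\<close>; this lemma makes that harmless for
  approximation.
\<close>

lemma LS_measure_endpoint_null:
  assumes F: "LS_integrator a b F"
  shows "AE x in LS_measure a b F. x \<noteq> b"
proof -
  have "emeasure (LS_measure a b F) {b..b} = 0"
    using F by (subst emeasure_LS_measure_Icc[OF F]) (auto simp: LS_integrator_def)
  moreover have "{b} \<in> sets (LS_measure a b F)"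
    using F by (auto simp: sets_LS_measure sets_restrict_space LS_integrator_def)
  ultimately show ?thesis by (intro AE_I[of _ _ "{b}"]) auto
qed

text \<open>
  The intervals \<open>{..<x}\<close> form a \<open>\<pi>\<close>-system that generates the Borel sets, and so do their traces on
  \<open>[a, b]\<close>.
\<close>

lemma borel_interval_induct [consumes 1, case_names basic empty compl union]:
  fixes a b :: real
  assumes A: "A \<in> sets (restrict_space borel {a..b})"
    and basic: "\<And>x. P ({a..b} \<inter> {..<x})"
    and empty: "P {}"
    and compl: "\<And>A. A \<in> sets (restrict_space borel {a..b}) \<Longrightarrow> P A \<Longrightarrow> P ({a..b} - A)"
    and union: "\<And>A. disjoint_family A \<Longrightarrow> range A \<subseteq> sets (restrict_space borel {a..b}) \<Longrightarrow>
      (\<And>i. P (A i)) \<Longrightarrow> P (\<Union>i::nat. A i)"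
  shows "P A"
proof -
  let ?E = "(\<inter>) {a..b} ` range lessThan"
  have borel: "sets borel = sigma_sets UNIV (range (lessThan :: real \<Rightarrow> _))"
    by (subst borel_eq_lessThan) (simp add: sets_measure_of eucl_less_def lessThan_def)
  have gen: "sets (restrict_space borel {a..b}) = sigma_sets {a..b} ?E"
    unfolding sets_restrict_space borel by (rule sigma_sets_Int) (simp_all flip: borel)
  have "Int_stable ?E"
  proof (intro Int_stableI)
    fix S T assume "S \<in> ?E" "T \<in> ?E"
    then obtain x y where "S = {a..b} \<inter> {..<x}" "T = {a..b} \<inter> {..<y}" by auto
    then have "S \<inter> T = {a..b} \<inter> {..<min x y}" by auto
    then show "S \<inter> T \<in> ?E" by auto
  qed
  moreover have "?E \<subseteq> Pow {a..b}" by auto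
  ultimately show ?thesis
    using A[unfolded gen]
    by (induction rule: sigma_sets_induct_disjoint)
      (auto simp: basic empty intro: compl[unfolded gen] union[unfolded gen])
qed

text \<open>
  Both sides are finite measures in \<open>A\<close>, so they agree once they agree on intervals.
\<close>

lemma measure_LS_measure_add:
  assumes F: "LS_integrator a b F" and G: "LS_integrator a b G"
    and A: "A \<in> sets (restrict_space borel {a..b})"
  shows "measure (LS_measure a b (\<lambda>t. F t + G t)) A = measure (LS_measure a b F) A + measure (LS_measure a b G) A"
  using A
proof (induction rule: borel_interval_induct)
  have FG: "LS_integrator a b (\<lambda>t. F t + G t)" by (rule LS_integrator_add[OF F G])
  interpret F: finite_measure "LS_measure a b F" by (rule finite_measure_LS_measure[OF F])
  interpret G: finite_measure "LS_measure a b G" by (rule finite_measure_LS_measure[OF G])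
  interpret FG: finite_measure "LS_measure a b (\<lambda>t. F t + G t)" by (rule finite_measure_LS_measure[OF FG])
  have "a \<le> b" using F by (simp add: LS_integrator_def)
  have total: "measure (LS_measure a b H) {a..b} = H b - H a" if "LS_integrator a b H" for H
    using emeasure_LS_measure_Icc[OF that, of a b] that
    by (simp add: measure_def LS_integrator_def mono_on_def)
  {
    case (basic x)
    consider "x \<le> a" | "a \<le> x" "x \<le> b" | "b < x" by linarith
    then show ?case
    proof cases
      case 1
      then have "{a..b} \<inter> {..<x} = {}" by auto
      then show ?thesis by simp
    next
      case 2
      then have "{a..b} \<inter> {..<x} = {a..<x}" by auto
      then show ?thesis using 2 by (simp add: measure_LS_measure_Ico F G FG)
    next
      case 3
      then have "{a..b} \<inter> {..<x} = {a..b}" by auto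
      then show ?thesis by (simp add: total F G FG)
    qed
  next
    case empty
    show ?case by simp
  next
    case (compl A)
    then show ?case
      using F.finite_measure_compl[of A] G.finite_measure_compl[of A] FG.finite_measure_compl[of A]
      by (simp add: sets_LS_measure total F G FG)
  next
    case (union A)
    then show ?case
      using sums_add[OF F.finite_measure_UNION[of A] G.finite_measure_UNION[of A]]
        FG.finite_measure_UNION[of A]
      by (auto simp: sets_LS_measure intro: sums_unique2)
  }
qed

lemma nn_integral_LS_measure_add:
  assumes F: "LS_integrator a b F" and G: "LS_integrator a b G"
    and f: "f \<in> borel_measurable (restrict_space borel {a..b})"
  shows "(\<integral>\<^sup>+x. f x \<partial>LS_measure a b (\<lambda>t. F t + G t)) =
    (\<integral>\<^sup>+x. f x \<partial>LS_measure a b F) + (\<integral>\<^sup>+x. f x \<partial>LS_measure a b G)"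
  using f
proof (induction rule: borel_measurable_induct)
  have FG: "LS_integrator a b (\<lambda>t. F t + G t)" by (rule LS_integrator_add[OF F G])
  interpret F: finite_measure "LS_measure a b F" by (rule finite_measure_LS_measure[OF F])
  interpret G: finite_measure "LS_measure a b G" by (rule finite_measure_LS_measure[OF G])
  interpret FG: finite_measure "LS_measure a b (\<lambda>t. F t + G t)" by (rule finite_measure_LS_measure[OF FG])
  {
    case (cong f g)
    have "(\<integral>\<^sup>+x. f x \<partial>LS_measure a b H) = (\<integral>\<^sup>+x. g x \<partial>LS_measure a b H)" for H
      using cong(3) by (intro nn_integral_cong) simp
    with cong(4) show ?case by simp
  next
    case (set A)
    then show ?case
      by (simp add: sets_LS_measure F.emeasure_eq_measure G.emeasure_eq_measure
          FG.emeasure_eq_measure measure_LS_measure_add[OF F G] flip: ennreal_plus)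
  next
    case (mult u c)
    have "(\<integral>\<^sup>+x. c * u x \<partial>LS_measure a b H) = c * (\<integral>\<^sup>+x. u x \<partial>LS_measure a b H)" for H
      using mult by (intro nn_integral_cmult) (simp cong: measurable_cong_sets add: sets_LS_measure)
    with mult show ?case by (simp add: distrib_left)
  next
    case (add u v)
    have "(\<integral>\<^sup>+x. v x + u x \<partial>LS_measure a b H) =
        (\<integral>\<^sup>+x. v x \<partial>LS_measure a b H) + (\<integral>\<^sup>+x. u x \<partial>LS_measure a b H)" for H
      using add by (intro nn_integral_add) (simp_all cong: measurable_cong_sets add: sets_LS_measure)
    with add show ?case by (simp add: ac_simps)
  next
    case (seq U)
    have mono: "incseq (\<lambda>i. \<integral>\<^sup>+x. U i x \<partial>LS_measure a b H)" for H
      using seq by (auto simp: incseq_def le_fun_def intro!: nn_integral_mono)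
    have "(\<integral>\<^sup>+x. (SUP i. U i) x \<partial>LS_measure a b H) = (SUP i. \<integral>\<^sup>+x. U i x \<partial>LS_measure a b H)" for H
      unfolding SUP_apply using seq
      by (intro nn_integral_monotone_convergence_SUP)
        (simp_all cong: measurable_cong_sets add: sets_LS_measure)
    then show ?case using seq by (simp add: ennreal_SUP_add mono)
  }
qed

text \<open>
  The measure of a sum of integrators dominates the measure of each summand. This is how control in
  \<open>L\<^sup>2 \<nu>\<close> passes to \<open>\<rho>\<close> and to the Jordan components of \<open>\<lambda>\<close>.
\<close>

lemma integrable_LS_measure_dominated:
  fixes f :: "real \<Rightarrow> real"
  assumes F: "LS_integrator a b F" and G: "LS_integrator a b G"
    and f: "integrable (LS_measure a b (\<lambda>t. F t + G t)) f" and nonneg: "\<And>x. 0 \<le> f x"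
  shows "integrable (LS_measure a b F) f"
    and "(\<integral>x. f x \<partial>LS_measure a b F) \<le> (\<integral>x. f x \<partial>LS_measure a b (\<lambda>t. F t + G t))"
proof -
  let ?N = "LS_measure a b (\<lambda>t. F t + G t)"
  have m: "f \<in> borel_measurable (restrict_space borel {a..b})"
    using borel_measurable_integrable[OF f] by (simp cong: measurable_cong_sets add: sets_LS_measure)
  have le: "(\<integral>\<^sup>+x. f x \<partial>LS_measure a b F) \<le> (\<integral>\<^sup>+x. f x \<partial>?N)"
    using m by (subst nn_integral_LS_measure_add[OF F G]) auto
  also have eq: "(\<integral>\<^sup>+x. f x \<partial>?N) = ennreal (\<integral>x. f x \<partial>?N)"
    by (rule nn_integral_eq_integral[OF f]) (simp add: nonneg)
  finally have bound: "(\<integral>\<^sup>+x. f x \<partial>LS_measure a b F) \<le> ennreal (\<integral>x. f x \<partial>?N)" .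
  show int: "integrable (LS_measure a b F) f"
    by (rule integrableI_nonneg)
      (use m nonneg bound in \<open>auto simp: sets_LS_measure less_top[symmetric] top_unique cong: measurable_cong_sets\<close>)
  show "(\<integral>x. f x \<partial>LS_measure a b F) \<le> (\<integral>x. f x \<partial>?N)"
    using bound nn_integral_eq_integral[OF int] nonneg by (simp add: integral_nonneg_AE)
qed

lemma integrable_LS_measure_add:
  fixes f :: "real \<Rightarrow> real"
  assumes F: "LS_integrator a b F" and G: "LS_integrator a b G"
    and f: "integrable (LS_measure a b F) f" "integrable (LS_measure a b G) f" and nonneg: "\<And>x. 0 \<le> f x"
  shows "integrable (LS_measure a b (\<lambda>t. F t + G t)) f"
proof -
  have m: "f \<in> borel_measurable (restrict_space borel {a..b})"
    using borel_measurable_integrable[OF f(1)] by (simp cong: measurable_cong_sets add: sets_LS_measure)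
  show ?thesis
  proof (rule integrableI_nonneg)
    show "(\<integral>\<^sup>+x. f x \<partial>LS_measure a b (\<lambda>t. F t + G t)) < \<infinity>"
      using m by (subst nn_integral_LS_measure_add[OF F G])
        (auto simp: nn_integral_eq_integral[OF f(1)] nn_integral_eq_integral[OF f(2)] nonneg)
  qed (use m nonneg in \<open>auto simp: sets_LS_measure cong: measurable_cong_sets\<close>)
qed

section \<open>Square-integrable functions\<close>

lemma L2_linear_combination:
  assumes "f \<in> L2 M" "g \<in> L2 M"
  shows "(\<lambda>x. \<alpha> * f x + \<beta> * g x) \<in> L2 M"
    and "(\<integral>x. (\<alpha> * f x + \<beta> * g x)\<^sup>2 \<partial>M) \<le> 2 * \<alpha>\<^sup>2 * (\<integral>x. (f x)\<^sup>2 \<partial>M) + 2 * \<beta>\<^sup>2 * (\<integral>x. (g x)\<^sup>2 \<partial>M)"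
proof -
  have [measurable]: "f \<in> borel_measurable M" "g \<in> borel_measurable M"
    and int: "integrable M (\<lambda>x. (f x)\<^sup>2)" "integrable M (\<lambda>x. (g x)\<^sup>2)"
    using assms by (auto simp: L2_def)
  have bound: "(\<alpha> * f x + \<beta> * g x)\<^sup>2 \<le> 2 * \<alpha>\<^sup>2 * (f x)\<^sup>2 + 2 * \<beta>\<^sup>2 * (g x)\<^sup>2" for x
    using zero_le_power2[of "\<alpha> * f x - \<beta> * g x"] by (simp add: power2_eq_square algebra_simps)
  have int_bound: "integrable M (\<lambda>x. 2 * \<alpha>\<^sup>2 * (f x)\<^sup>2 + 2 * \<beta>\<^sup>2 * (g x)\<^sup>2)"
    using int by auto
  have int_sq: "integrable M (\<lambda>x. (\<alpha> * f x + \<beta> * g x)\<^sup>2)"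
    by (rule Bochner_Integration.integrable_bound[OF int_bound])
      (use bound in \<open>auto intro: order.trans[OF _ abs_ge_self]\<close>)
  then show "(\<lambda>x. \<alpha> * f x + \<beta> * g x) \<in> L2 M" by (simp add: L2_def)
  have "(\<integral>x. (\<alpha> * f x + \<beta> * g x)\<^sup>2 \<partial>M) \<le> (\<integral>x. 2 * \<alpha>\<^sup>2 * (f x)\<^sup>2 + 2 * \<beta>\<^sup>2 * (g x)\<^sup>2 \<partial>M)"
    by (rule integral_mono[OF int_sq int_bound bound])
  then show "(\<integral>x. (\<alpha> * f x + \<beta> * g x)\<^sup>2 \<partial>M) \<le> 2 * \<alpha>\<^sup>2 * (\<integral>x. (f x)\<^sup>2 \<partial>M) + 2 * \<beta>\<^sup>2 * (\<integral>x. (g x)\<^sup>2 \<partial>M)"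
    using int by simp
qed

lemma L2_diff: "f \<in> L2 M \<Longrightarrow> g \<in> L2 M \<Longrightarrow> (\<lambda>x. f x - g x) \<in> L2 M"
  using L2_linear_combination(1)[of f M g 1 "-1"] by simp

lemma L2_dist_triangle:
  assumes "f \<in> L2 M" "g \<in> L2 M" "h \<in> L2 M"
  shows "(\<integral>x. (f x - h x)\<^sup>2 \<partial>M) \<le> 2 * (\<integral>x. (f x - g x)\<^sup>2 \<partial>M) + 2 * (\<integral>x. (g x - h x)\<^sup>2 \<partial>M)"
  using L2_linear_combination(2)[OF L2_diff[OF assms(1,2)] L2_diff[OF assms(2,3)], of 1 1] by simp

lemma L2_integrable_mult:
  assumes "f \<in> L2 M" "g \<in> L2 M"
  shows "integrable M (\<lambda>x. f x * g x)"
proof -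
  have "integrable M (\<lambda>x. ((f x + g x)\<^sup>2 - (f x - g x)\<^sup>2) / 4)"
    using L2_linear_combination(1)[OF assms, of 1 1] L2_diff[OF assms] by (simp add: L2_def)
  then show ?thesis by (simp add: power2_eq_square algebra_simps)
qed

text \<open>
  Evaluate \<open>0 \<le> \<integral>(s f - p g)\<^sup>2\<close> at \<open>s = \<integral>g\<^sup>2\<close> and \<open>p = \<integral>f g\<close>; this yields the claim multiplied by
  \<open>\<integral>g\<^sup>2\<close>, so the case \<open>\<integral>g\<^sup>2 = 0\<close> is separate.
\<close>

lemma L2_Cauchy_Schwarz:
  assumes f: "f \<in> L2 M" and g: "g \<in> L2 M"
  shows "(\<integral>x. f x * g x \<partial>M)\<^sup>2 \<le> (\<integral>x. (f x)\<^sup>2 \<partial>M) * (\<integral>x. (g x)\<^sup>2 \<partial>M)"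
proof -
  have int: "integrable M (\<lambda>x. (f x)\<^sup>2)" "integrable M (\<lambda>x. (g x)\<^sup>2)" "integrable M (\<lambda>x. f x * g x)"
    using f g L2_integrable_mult[OF f g] by (auto simp: L2_def)
  let ?F = "\<integral>x. (f x)\<^sup>2 \<partial>M" and ?G = "\<integral>x. (g x)\<^sup>2 \<partial>M" and ?P = "\<integral>x. f x * g x \<partial>M"
  show ?thesis
  proof (cases "?G = 0")
    case True
    then have "AE x in M. (g x)\<^sup>2 = 0"
      using int(2) by (subst (asm) integral_nonneg_eq_0_iff_AE) auto
    then have "AE x in M. f x * g x = 0" by eventually_elim auto
    then have "?P = 0" by (rule integral_eq_zero_AE)
    with True show ?thesis by simp
  next
    case False
    then have "0 < ?G" by (simp add: less_le)
    have "0 \<le> (\<integral>x. (?G * f x - ?P * g x)\<^sup>2 \<partial>M)" by simp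
    also have "(\<lambda>x. (?G * f x - ?P * g x)\<^sup>2) =
        (\<lambda>x. ?G\<^sup>2 * (f x)\<^sup>2 - 2 * ?G * ?P * (f x * g x) + ?P\<^sup>2 * (g x)\<^sup>2)"
      by (simp add: power2_eq_square algebra_simps)
    also have "(\<integral>x. ?G\<^sup>2 * (f x)\<^sup>2 - 2 * ?G * ?P * (f x * g x) + ?P\<^sup>2 * (g x)\<^sup>2 \<partial>M) =
        ?G\<^sup>2 * ?F - 2 * ?G * ?P * ?P + ?P\<^sup>2 * ?G"
      using int by simp
    also have "\<dots> = ?G * (?F * ?G - ?P\<^sup>2)" by (simp add: power2_eq_square algebra_simps)
    finally show ?thesis using \<open>0 < ?G\<close> by (simp add: zero_le_mult_iff)
  qed
qed

lemma (in finite_measure) L2_integrable: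
  assumes "f \<in> L2 M"
  shows "integrable M f" "(\<integral>x. f x \<partial>M)\<^sup>2 \<le> measure M (space M) * (\<integral>x. (f x)\<^sup>2 \<partial>M)"
proof -
  have "(\<lambda>_. 1) \<in> L2 M" by (simp add: L2_def)
  then show "integrable M f" "(\<integral>x. f x \<partial>M)\<^sup>2 \<le> measure M (space M) * (\<integral>x. (f x)\<^sup>2 \<partial>M)"
    using L2_integrable_mult[OF assms, of "\<lambda>_. 1"] L2_Cauchy_Schwarz[OF assms, of "\<lambda>_. 1"]
    by (simp_all add: mult.commute)
qed

lemma tendsto_L2_linear_combination:
  assumes f: "tendsto_L2 M u f" and g: "tendsto_L2 M v g"
  shows "tendsto_L2 M (\<lambda>k x. \<alpha> * u k x + \<beta> * v k x) (\<lambda>x. \<alpha> * f x + \<beta> * g x)"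
proof -
  have L2: "u k \<in> L2 M" "v k \<in> L2 M" "f \<in> L2 M" "g \<in> L2 M" for k
    using f g by (auto simp: tendsto_L2_def)
  let ?D = "\<lambda>k. \<integral>x. (\<alpha> * u k x + \<beta> * v k x - (\<alpha> * f x + \<beta> * g x))\<^sup>2 \<partial>M"
  let ?B = "\<lambda>k. 2 * \<alpha>\<^sup>2 * (\<integral>x. (u k x - f x)\<^sup>2 \<partial>M) + 2 * \<beta>\<^sup>2 * (\<integral>x. (v k x - g x)\<^sup>2 \<partial>M)"
  have "?B \<longlonglongrightarrow> 2 * \<alpha>\<^sup>2 * 0 + 2 * \<beta>\<^sup>2 * 0"
    using f g unfolding tendsto_L2_def by (intro tendsto_intros) auto
  then have lim: "?B \<longlonglongrightarrow> 0" by simp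
  have "?D k \<le> ?B k" for k
    using L2_linear_combination(2)[OF L2_diff[OF L2(1,3)] L2_diff[OF L2(2,4)], of \<alpha> k \<beta> k]
    by (simp add: algebra_simps)
  then have "?D \<longlonglongrightarrow> 0"
    by (intro tendsto_sandwich[OF _ _ tendsto_const lim]) auto
  then show ?thesis
    unfolding tendsto_L2_def using L2 by (auto intro: L2_linear_combination)
qed

lemma tendsto_L2_perturb:
  assumes u: "tendsto_L2 M u f" and v: "\<And>k. v k \<in> L2 M"
    and dist: "(\<lambda>k. \<integral>x. (v k x - u k x)\<^sup>2 \<partial>M) \<longlonglongrightarrow> 0"
  shows "tendsto_L2 M v f"
proof -
  have L2: "u k \<in> L2 M" "f \<in> L2 M" for k using u by (auto simp: tendsto_L2_def)
  let ?B = "\<lambda>k. 2 * (\<integral>x. (v k x - u k x)\<^sup>2 \<partial>M) + 2 * (\<integral>x. (u k x - f x)\<^sup>2 \<partial>M)"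
  have "?B \<longlonglongrightarrow> 2 * 0 + 2 * 0"
    using u dist unfolding tendsto_L2_def by (intro tendsto_intros) auto
  then have lim: "?B \<longlonglongrightarrow> 0" by simp
  have "(\<lambda>k. \<integral>x. (v k x - f x)\<^sup>2 \<partial>M) \<longlonglongrightarrow> 0"
    by (rule tendsto_sandwich[OF _ _ tendsto_const lim])
      (auto intro!: always_eventually L2_dist_triangle v L2)
  then show ?thesis unfolding tendsto_L2_def using L2 v by auto
qed

lemma tendsto_L2_dist:
  assumes u: "tendsto_L2 M u f" and v: "tendsto_L2 M v f"
  shows "(\<lambda>k. \<integral>x. (v k x - u k x)\<^sup>2 \<partial>M) \<longlonglongrightarrow> 0"
  using tendsto_L2_linear_combination[OF v u, of 1 "-1"] by (simp add: tendsto_L2_def)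

lemma tendsto_L2_unique:
  assumes "tendsto_L2 M u f" "tendsto_L2 M u g"
  shows "AE x in M. f x = g x"
proof -
  have L2: "f \<in> L2 M" "g \<in> L2 M" using assms by (auto simp: tendsto_L2_def)
  have "(\<lambda>k. \<integral>x. (1 * u k x + (-1) * u k x - (1 * f x + (-1) * g x))\<^sup>2 \<partial>M) \<longlonglongrightarrow> 0"
    using tendsto_L2_linear_combination[OF assms, of 1 "-1"] unfolding tendsto_L2_def by blast
  then have "(\<integral>x. (g x - f x)\<^sup>2 \<partial>M) = 0" by (simp add: LIMSEQ_const_iff)
  then have "AE x in M. (g x - f x)\<^sup>2 = 0"
    using L2_diff[OF L2(2,1)] by (subst (asm) integral_nonneg_eq_0_iff_AE) (auto simp: L2_def)
  then show ?thesis by eventually_elim auto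
qed

lemma tendsto_L2_cong_AE:
  assumes "tendsto_L2 M u f" "AE x in M. f x = g x" "g \<in> L2 M"
  shows "tendsto_L2 M u g"
proof -
  have [measurable]: "u k \<in> borel_measurable M" "f \<in> borel_measurable M" "g \<in> borel_measurable M" for k
    using assms by (auto simp: tendsto_L2_def L2_def)
  have "(\<integral>x. (u k x - f x)\<^sup>2 \<partial>M) = (\<integral>x. (u k x - g x)\<^sup>2 \<partial>M)" for k
    using assms(2) by (intro integral_cong_AE) auto
  with assms show ?thesis by (simp add: tendsto_L2_def)
qed

text \<open>
  In \<open>\<integral>u\<^sub>k\<^sup>2 = \<integral>(u\<^sub>k - f)\<^sup>2 + 2 \<integral>(u\<^sub>k - f) f + \<integral>f\<^sup>2\<close> the middle term tends to \<open>0\<close> by Cauchy-Schwarz.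
\<close>

lemma tendsto_L2_integral_square:
  assumes "tendsto_L2 M u f"
  shows "(\<lambda>k. \<integral>x. (u k x)\<^sup>2 \<partial>M) \<longlonglongrightarrow> (\<integral>x. (f x)\<^sup>2 \<partial>M)"
proof -
  have L2: "u k \<in> L2 M" "f \<in> L2 M" "(\<lambda>x. u k x - f x) \<in> L2 M" for k
    using assms L2_diff by (auto simp: tendsto_L2_def)
  let ?D = "\<lambda>k. \<integral>x. (u k x - f x)\<^sup>2 \<partial>M" and ?P = "\<lambda>k. \<integral>x. (u k x - f x) * f x \<partial>M"
    and ?F = "\<integral>x. (f x)\<^sup>2 \<partial>M"
  have D: "?D \<longlonglongrightarrow> 0" using assms by (simp add: tendsto_L2_def)
  have "(\<lambda>k. sqrt (?D k * ?F)) \<longlonglongrightarrow> sqrt (0 * ?F)"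
    by (intro tendsto_intros D)
  then have lim: "(\<lambda>k. sqrt (?D k * ?F)) \<longlonglongrightarrow> 0" by simp
  have bound: "norm (?P k) \<le> sqrt (?D k * ?F)" for k
    unfolding real_norm_def by (rule real_le_rsqrt) (simp only: power2_abs L2_Cauchy_Schwarz[OF L2(3,2)])
  have P: "?P \<longlonglongrightarrow> 0"
    by (rule Lim_null_comparison[OF always_eventually lim]) (intro allI bound)
  have "(\<integral>x. (u k x)\<^sup>2 \<partial>M) = ?D k + 2 * ?P k + ?F" for k
  proof -
    have "(\<integral>x. (u k x)\<^sup>2 \<partial>M) = (\<integral>x. (u k x - f x)\<^sup>2 + 2 * ((u k x - f x) * f x) + (f x)\<^sup>2 \<partial>M)"
      by (intro Bochner_Integration.integral_cong refl) (simp add: power2_eq_square algebra_simps)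
    also have "\<dots> = ?D k + 2 * ?P k + ?F"
      using L2 L2_integrable_mult[OF L2(3,2)] by (simp add: L2_def)
    finally show ?thesis .
  qed
  moreover have "(\<lambda>k. ?D k + 2 * ?P k + ?F) \<longlonglongrightarrow> 0 + 2 * 0 + ?F"
    by (intro tendsto_intros D P)
  ultimately show ?thesis by simp
qed

lemma (in finite_measure) tendsto_L2_integral:
  assumes "tendsto_L2 M u f"
  shows "(\<lambda>k. \<integral>x. u k x \<partial>M) \<longlonglongrightarrow> (\<integral>x. f x \<partial>M)"
proof -
  have L2: "u k \<in> L2 M" "f \<in> L2 M" "(\<lambda>x. u k x - f x) \<in> L2 M" for k
    using assms L2_diff by (auto simp: tendsto_L2_def)
  let ?D = "\<lambda>k. \<integral>x. (u k x - f x)\<^sup>2 \<partial>M"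
  have "(\<lambda>k. sqrt (measure M (space M) * ?D k)) \<longlonglongrightarrow> sqrt (measure M (space M) * 0)"
    using assms unfolding tendsto_L2_def by (intro tendsto_intros) auto
  then have lim: "(\<lambda>k. sqrt (measure M (space M) * ?D k)) \<longlonglongrightarrow> 0" by simp
  have bound: "norm (\<integral>x. u k x - f x \<partial>M) \<le> sqrt (measure M (space M) * ?D k)" for k
    unfolding real_norm_def by (rule real_le_rsqrt) (simp only: power2_abs L2_integrable(2)[OF L2(3)])
  have "(\<lambda>k. \<integral>x. u k x - f x \<partial>M) \<longlonglongrightarrow> 0"
    by (rule Lim_null_comparison[OF always_eventually lim]) (intro allI bound)
  then show ?thesis
    by (simp add: Bochner_Integration.integral_diff[OF L2_integrable(1)[OF L2(1)] L2_integrable(1)[OF L2(2)]]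
        LIM_zero_iff)
qed

text \<open>
  The Riesz-Fischer theorem. On a finite measure space an \<open>L\<^sup>2\<close>-Cauchy sequence is \<open>L\<^sup>1\<close>-Cauchy, so a
  subsequence converges almost everywhere; Fatou's lemma turns the pointwise limit into an
  \<open>L\<^sup>2\<close>-limit.
\<close>

lemma (in finite_measure) L2_complete:
  assumes u: "\<And>k. u k \<in> L2 M"
    and Cauchy: "\<And>e. 0 < e \<Longrightarrow> \<exists>N. \<forall>i\<ge>N. \<forall>j\<ge>N. (\<integral>x. (u i x - u j x)\<^sup>2 \<partial>M) < e"
  obtains f where "tendsto_L2 M u f"
proof -
  have [measurable]: "u k \<in> borel_measurable M" for k using u by (simp add: L2_def)
  have diff: "(\<lambda>x. u i x - u j x) \<in> L2 M" for i j by (intro L2_diff u)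
  have "\<exists>N. \<forall>i\<ge>N. \<forall>j\<ge>N. (\<integral>x. norm (u i x - u j x) \<partial>M) < e" if "0 < e" for e
  proof -
    let ?m = "measure M (space M)"
    have "0 < e\<^sup>2 / (?m + 1)" using \<open>0 < e\<close> by (simp add: add_nonneg_pos)
    from Cauchy[OF this] obtain N where
      N: "\<And>i j. N \<le> i \<Longrightarrow> N \<le> j \<Longrightarrow> (\<integral>x. (u i x - u j x)\<^sup>2 \<partial>M) < e\<^sup>2 / (?m + 1)" by blast
    have "(\<integral>x. norm (u i x - u j x) \<partial>M) < e" if ij: "N \<le> i" "N \<le> j" for i j
    proof -
      let ?D = "\<integral>x. (u i x - u j x)\<^sup>2 \<partial>M"
      have "(\<lambda>x. \<bar>u i x - u j x\<bar>) \<in> L2 M" using diff[of i j] by (simp add: L2_def)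
      from L2_integrable(2)[OF this]
      have "(\<integral>x. \<bar>u i x - u j x\<bar> \<partial>M)\<^sup>2 \<le> ?m * ?D" by simp
      also have "\<dots> \<le> (?m + 1) * ?D" by (intro mult_right_mono) auto
      also have "\<dots> < e\<^sup>2" using N[OF ij] by (simp add: pos_less_divide_eq add_nonneg_pos mult.commute)
      finally show ?thesis using \<open>0 < e\<close> by (simp add: power2_less_imp_less)
    qed
    then show ?thesis by blast
  qed
  from cauchy_L1_AE_cauchy_subseq[OF L2_integrable(1)[OF u] this]
  obtain r where r: "strict_mono r" and AE_Cauchy: "AE x in M. Cauchy (\<lambda>i. u (r i) x)" by blast
  define f where "f x = lim (\<lambda>i. u (r i) x)" for x
  have [measurable]: "f \<in> borel_measurable M" unfolding f_def by measurable
  have AE_lim: "AE x in M. (\<lambda>i. u (r i) x) \<longlonglongrightarrow> f x"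
    using AE_Cauchy by eventually_elim (auto simp: f_def Cauchy_convergent_iff convergent_LIMSEQ_iff)
  have bound: "\<exists>N. \<forall>k\<ge>N. (\<lambda>x. u k x - f x) \<in> L2 M \<and> (\<integral>x. (u k x - f x)\<^sup>2 \<partial>M) \<le> e"
    if "0 < e" for e
  proof -
    from Cauchy[OF \<open>0 < e\<close>] obtain N where
      N: "\<And>i j. N \<le> i \<Longrightarrow> N \<le> j \<Longrightarrow> (\<integral>x. (u i x - u j x)\<^sup>2 \<partial>M) < e" by blast
    have "(\<lambda>x. u k x - f x) \<in> L2 M \<and> (\<integral>x. (u k x - f x)\<^sup>2 \<partial>M) \<le> e" if "N \<le> k" for k
    proof -
      have "AE x in M. (\<lambda>i. ennreal ((u k x - u (r i) x)\<^sup>2)) \<longlonglongrightarrow> ennreal ((u k x - f x)\<^sup>2)"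
        using AE_lim by eventually_elim (intro tendsto_intros)
      then have "AE x in M. ennreal ((u k x - f x)\<^sup>2) = liminf (\<lambda>i. ennreal ((u k x - u (r i) x)\<^sup>2))"
        by eventually_elim (intro lim_imp_Liminf[symmetric] trivial_limit_sequentially)
      then have "(\<integral>\<^sup>+x. (u k x - f x)\<^sup>2 \<partial>M) = (\<integral>\<^sup>+x. liminf (\<lambda>i. ennreal ((u k x - u (r i) x)\<^sup>2)) \<partial>M)"
        by (rule nn_integral_cong_AE)
      also have "\<dots> \<le> liminf (\<lambda>i. \<integral>\<^sup>+x. (u k x - u (r i) x)\<^sup>2 \<partial>M)"
        by (intro nn_integral_liminf) measurable
      also have "\<dots> \<le> liminf (\<lambda>i. ennreal e)"
      proof (rule Liminf_mono)
        have "(\<integral>\<^sup>+x. (u k x - u (r i) x)\<^sup>2 \<partial>M) \<le> ennreal e" if "N \<le> i" for i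
        proof -
          have "N \<le> r i" using seq_suble[OF r, of i] that by linarith
          with N[OF \<open>N \<le> k\<close> this] show ?thesis
            using diff[of k "r i"] by (subst nn_integral_eq_integral) (auto simp: L2_def ennreal_leI)
        qed
        then show "\<forall>\<^sub>F i in sequentially. (\<integral>\<^sup>+x. (u k x - u (r i) x)\<^sup>2 \<partial>M) \<le> ennreal e"
          by (rule eventually_sequentiallyI)
      qed
      finally have le: "(\<integral>\<^sup>+x. (u k x - f x)\<^sup>2 \<partial>M) \<le> ennreal e" by (simp add: Liminf_const)
      have int: "integrable M (\<lambda>x. (u k x - f x)\<^sup>2)"
        by (rule integrableI_nonneg) (use le in \<open>auto simp: less_top[symmetric] top_unique\<close>)
      have "(\<integral>x. (u k x - f x)\<^sup>2 \<partial>M) \<le> e"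
        using le nn_integral_eq_integral[OF int] \<open>0 < e\<close> by simp
      with int show ?thesis by (simp add: L2_def)
    qed
    then show ?thesis by blast
  qed
  obtain N where "(\<lambda>x. u N x - f x) \<in> L2 M" using bound[of 1] by auto
  from L2_diff[OF u[of N] this] have f: "f \<in> L2 M" by simp
  have "(\<lambda>k. \<integral>x. (u k x - f x)\<^sup>2 \<partial>M) \<longlonglongrightarrow> 0"
  proof (rule LIMSEQ_I)
    fix e :: real assume "0 < e"
    then obtain N where "\<forall>k\<ge>N. (\<integral>x. (u k x - f x)\<^sup>2 \<partial>M) \<le> e / 2" using bound[of "e / 2"] by auto
    with \<open>0 < e\<close> show "\<exists>N. \<forall>k\<ge>N. norm ((\<integral>x. (u k x - f x)\<^sup>2 \<partial>M) - 0) < e"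
      by (intro exI[of _ N]) force
  qed
  with u f have "tendsto_L2 M u f" by (simp add: tendsto_L2_def)
  then show ?thesis by (rule that)
qed

lemma tendsto_L2_dominated:
  assumes u [measurable]: "\<And>k. u k \<in> borel_measurable M" and g: "g \<in> L2 M"
    and bound: "\<And>k x. x \<in> space M \<Longrightarrow> \<bar>u k x\<bar> \<le> \<bar>g x\<bar>"
    and lim: "\<And>x. x \<in> space M \<Longrightarrow> (\<lambda>k. u k x) \<longlonglongrightarrow> f x"
  shows "tendsto_L2 M u f"
proof -
  have [measurable]: "f \<in> borel_measurable M" by (rule borel_measurable_LIMSEQ_real[OF lim u])
  have [measurable]: "g \<in> borel_measurable M" and int: "integrable M (\<lambda>x. (g x)\<^sup>2)"
    using g by (auto simp: L2_def)
  have f_bound: "\<bar>f x\<bar> \<le> \<bar>g x\<bar>" if "x \<in> space M" for x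
    by (rule LIMSEQ_le_const2[OF tendsto_rabs[OF lim[OF that]]]) (use bound[OF that] in auto)
  have "u k \<in> L2 M" for k
    unfolding L2_def
    by (auto intro!: Bochner_Integration.integrable_bound[OF int] AE_I2 simp: bound simp flip: abs_le_square_iff)
  moreover have "f \<in> L2 M"
    unfolding L2_def
    by (auto intro!: Bochner_Integration.integrable_bound[OF int] AE_I2 simp: f_bound simp flip: abs_le_square_iff)
  moreover have "(\<lambda>k. \<integral>x. (u k x - f x)\<^sup>2 \<partial>M) \<longlonglongrightarrow> (\<integral>x. 0 \<partial>M)"
  proof (rule integral_dominated_convergence[where w = "\<lambda>x. 4 * (g x)\<^sup>2"])
    show "AE x in M. (\<lambda>k. (u k x - f x)\<^sup>2) \<longlonglongrightarrow> 0"
    proof (rule AE_I2)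
      fix x assume "x \<in> space M"
      then have "(\<lambda>k. (u k x - f x)\<^sup>2) \<longlonglongrightarrow> (f x - f x)\<^sup>2" by (intro tendsto_intros lim)
      then show "(\<lambda>k. (u k x - f x)\<^sup>2) \<longlonglongrightarrow> 0" by simp
    qed
    show "AE x in M. norm ((u k x - f x)\<^sup>2) \<le> 4 * (g x)\<^sup>2" for k
    proof (rule AE_I2)
      fix x assume x: "x \<in> space M"
      have "\<bar>u k x - f x\<bar> \<le> \<bar>2 * g x\<bar>" using bound[OF x, of k] f_bound[OF x] by linarith
      then have "(u k x - f x)\<^sup>2 \<le> (2 * g x)\<^sup>2" by (simp only: abs_le_square_iff)
      then show "norm ((u k x - f x)\<^sup>2) \<le> 4 * (g x)\<^sup>2" by (simp add: power_mult_distrib)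
    qed
  qed (use int in auto)
  ultimately show ?thesis by (simp add: tendsto_L2_def)
qed

section \<open>Step functions\<close>

lemma partition_through_finite_set:
  assumes "finite D" "a \<in> D" "b \<in> D" "D \<subseteq> {a..b}"
  obtains n t where "is_partition a b n t" "t ` {..n} = D"
proof
  let ?l = "sorted_list_of_set D"
  let ?n = "length ?l - 1"
  have set: "set ?l = D" using assms(1) by simp
  have sorted: "sorted_wrt (<) ?l" by simp
  have "?l \<noteq> []" using set assms(2) by auto
  then have len: "i \<le> ?n \<longleftrightarrow> i < length ?l" for i by (cases ?l) auto
  have less: "?l ! i < ?l ! j" if "i < j" "j \<le> ?n" for i j
    using sorted_wrt_nth_less[OF sorted \<open>i < j\<close>] that len by simp
  have image: "(!) ?l ` {..?n} = D"
    using set len by (auto simp: set_conv_nth)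
  then show "(!) ?l ` {..?n} = D" .
  have in_D: "?l ! i \<in> {a..b}" if "i \<le> ?n" for i using image that assms(4) by blast
  have "a \<in> (!) ?l ` {..?n}" "b \<in> (!) ?l ` {..?n}" unfolding image by (fact assms)+
  then obtain i j where ij: "i \<le> ?n" "a = ?l ! i" "j \<le> ?n" "b = ?l ! j"
    unfolding image_iff Bex_def atMost_iff by blast
  have "?l ! 0 = a"
  proof (cases "i = 0")
    case False
    then have "?l ! 0 < a" unfolding ij(2) using ij(1) by (intro less) auto
    with in_D[of 0] show ?thesis by simp
  qed (simp add: ij(2))
  moreover have "?l ! ?n = b"
  proof (cases "j = ?n")
    case False
    then have "b < ?l ! ?n" unfolding ij(4) using ij(3) by (intro less) linarith+
    with in_D[of ?n] show ?thesis by simp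
  qed (simp add: ij(4))
  ultimately have "?l ! 0 = a" "?l ! ?n = b" .
  then show "is_partition a b ?n ((!) ?l)"
    unfolding is_partition_def by (auto intro!: less)
qed

text \<open>
  Summing the increments of a path \<open>Y\<close> over the cells inside \<open>[s k, s l)\<close> telescopes. For a stochastic
  path this says that the Wiener integral of a step function survives refinement of the partition,
  and for the path \<open>u \<mapsto> 1\<^bsub>x < u\<^esub>\<close> it says the same about the step function itself.
\<close>

lemma sum_increments_over_interval:
  fixes Y :: "real \<Rightarrow> real"
  assumes s: "is_partition a b m s" and "k \<le> l" "l \<le> m"
  shows "(\<Sum>j=1..m. indicator {s k..<s l} (s (j - 1)) * (Y (s j) - Y (s (j - 1)))) = Y (s l) - Y (s k)"
proof -
  have cell: "s (j - 1) \<in> {s k..<s l} \<longleftrightarrow> j \<in> {Suc k..l}" if "j \<in> {1..m}" for j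
  proof -
    have "s k \<le> s (j - 1) \<longleftrightarrow> k \<le> j - 1"
    proof (cases "k \<le> j - 1")
      case True
      then show ?thesis using that by (auto intro!: is_partition_mono[OF s])
    next
      case False
      then show ?thesis using is_partition_strict_mono[OF s, of "j - 1" k] assms by auto
    qed
    moreover have "s (j - 1) < s l \<longleftrightarrow> j - 1 < l"
    proof (cases "j - 1 < l")
      case True
      then show ?thesis using \<open>l \<le> m\<close> by (auto intro!: is_partition_strict_mono[OF s])
    next
      case False
      then show ?thesis using is_partition_mono[OF s, of l "j - 1"] that by fastforce
    qed
    ultimately show ?thesis using that by auto
  qed
  have "indicator {s k..<s l} (s (j - 1)) * d = (if j \<in> {Suc k..l} then d else 0)"
    if "j \<in> {1..m}" for j and d :: real
    using cell[OF that]
    by (cases "j \<in> {Suc k..l}") (simp_all only: indicator_simps simp_thms if_True if_False mult_1 mult_zero_left)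
  then have "(\<Sum>j=1..m. indicator {s k..<s l} (s (j - 1)) * (Y (s j) - Y (s (j - 1)))) =
      (\<Sum>j=1..m. if j \<in> {Suc k..l} then Y (s j) - Y (s (j - 1)) else 0)"
    by (intro sum.cong refl)
  also have "\<dots> = (\<Sum>j\<in>{1..m} \<inter> {Suc k..l}. Y (s j) - Y (s (j - 1)))"
    by (rule sum.inter_restrict[symmetric]) simp
  also have "{1..m} \<inter> {Suc k..l} = {Suc k..l}" using \<open>l \<le> m\<close> by auto
  also have "(\<Sum>j\<in>{Suc k..l}. Y (s j) - Y (s (j - 1))) = Y (s l) - Y (s k)"
    using sum_telescope''[OF \<open>k \<le> l\<close>, of "\<lambda>i. Y (s i)"] by simp
  finally show ?thesis .
qed

lemma step_integral_refine:
  assumes t: "is_partition a b n t" and s: "is_partition a b m s" and sub: "t ` {..n} \<subseteq> s ` {..m}"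
  shows "step_integral X m s (\<lambda>j. step_fun n t c (s (j - 1))) \<omega> = step_integral X n t c \<omega>"
proof -
  have increment: "(\<Sum>j=1..m. indicator {t (i - 1)..<t i} (s (j - 1)) * (X (s j) \<omega> - X (s (j - 1)) \<omega>)) =
      X (t i) \<omega> - X (t (i - 1)) \<omega>" if i: "i \<in> {1..n}" for i
  proof -
    have "t i \<in> s ` {..m}" "t (i - 1) \<in> s ` {..m}" using sub i by auto
    then obtain k l where kl: "k \<le> m" "l \<le> m" "t (i - 1) = s k" "t i = s l" by auto
    moreover have "k \<le> l"
      using is_partition_strict_mono[OF t, of "i - 1" i] is_partition_strict_mono[OF s, of l k] kl i
      by (cases "k \<le> l") auto
    ultimately show ?thesis
      using sum_increments_over_interval[OF s, of k l "\<lambda>u. X u \<omega>"] by simp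
  qed
  have "step_integral X m s (\<lambda>j. step_fun n t c (s (j - 1))) \<omega> =
      (\<Sum>j=1..m. \<Sum>i=1..n. c i * (indicator {t (i - 1)..<t i} (s (j - 1)) * (X (s j) \<omega> - X (s (j - 1)) \<omega>)))"
    unfolding step_integral_def step_fun_def sum_distrib_right mult.assoc ..
  also have "\<dots> = (\<Sum>i=1..n. c i * (\<Sum>j=1..m. indicator {t (i - 1)..<t i} (s (j - 1)) * (X (s j) \<omega> - X (s (j - 1)) \<omega>)))"
    unfolding sum_distrib_left by (rule sum.swap)
  also have "\<dots> = step_integral X n t c \<omega>"
    unfolding step_integral_def by (intro sum.cong refl) (simp only: increment)
  finally show ?thesis .
qed

lemma step_fun_eq_step_integral:
  assumes "is_partition a b n t"
  shows "step_fun n t c x = step_integral (\<lambda>u x. if x < u then 1 else 0) n t c x"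
  unfolding step_fun_def step_integral_def
proof (intro sum.cong refl)
  fix i assume "i \<in> {1..n}"
  then have "t (i - 1) < t i" using assms by (simp add: is_partition_def)
  then show "c i * indicator {t (i - 1)..<t i} x =
      c i * ((if x < t i then 1 else 0) - (if x < t (i - 1) then 1 else 0))"
    by (auto simp: indicator_def)
qed

lemma common_refinement:
  fixes X :: "real \<Rightarrow> 'w \<Rightarrow> real"
  assumes t: "is_partition a b n t" and t': "is_partition a b n' t'"
  obtains m s d d' where "is_partition a b m s"
    "step_fun m s d = step_fun n t c" "step_integral X m s d = step_integral X n t c"
    "step_fun m s d' = step_fun n' t' c'" "step_integral X m s d' = step_integral X n' t' c'"
proof -
  let ?D = "t ` {..n} \<union> t' ` {..n'}"
  have "a \<in> ?D" "b \<in> ?D" using t by (auto simp: is_partition_def)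
  moreover have "?D \<subseteq> {a..b}"
    using is_partition_bounds[OF t] is_partition_bounds[OF t'] by auto
  ultimately obtain m s where s: "is_partition a b m s" "s ` {..m} = ?D"
    using partition_through_finite_set[of ?D a b] by (metis finite_UnI finite_atMost finite_imageI)
  have refine: "step_fun m s (\<lambda>j. step_fun k r e (s (j - 1))) = step_fun k r e"
    "step_integral X m s (\<lambda>j. step_fun k r e (s (j - 1))) = step_integral X k r e"
    if r: "is_partition a b k r" "r ` {..k} \<subseteq> ?D" for k r e
  proof -
    note refine = step_integral_refine[OF r(1) s(1) r(2)[folded s(2)]]
    show "step_fun m s (\<lambda>j. step_fun k r e (s (j - 1))) = step_fun k r e"
    proof
      fix x
      show "step_fun m s (\<lambda>j. step_fun k r e (s (j - 1))) x = step_fun k r e x"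
        unfolding step_fun_eq_step_integral[OF s(1)] step_fun_eq_step_integral[OF r(1), of e x]
        by (rule refine)
    qed
    show "step_integral X m s (\<lambda>j. step_fun k r e (s (j - 1))) = step_integral X k r e"
      by (rule ext) (rule refine)
  qed
  show ?thesis
    by (rule that[OF s(1) refine[OF t] refine[OF t']]) auto
qed

lemma step_fun_linear:
  "step_fun n t (\<lambda>i. \<alpha> * c i + \<beta> * d i) x = \<alpha> * step_fun n t c x + \<beta> * step_fun n t d x"
  unfolding step_fun_def sum_distrib_left sum.distrib[symmetric]
  by (intro sum.cong refl) (simp only: algebra_simps)

lemma step_integral_linear:
  "step_integral X n t (\<lambda>i. \<alpha> * c i + \<beta> * d i) \<omega> =
    \<alpha> * step_integral X n t c \<omega> + \<beta> * step_integral X n t d \<omega>"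
  unfolding step_integral_def sum_distrib_left sum.distrib[symmetric]
  by (intro sum.cong refl) (simp only: algebra_simps)

lemma step_fun_linear_combination:
  fixes X :: "real \<Rightarrow> 'w \<Rightarrow> real"
  assumes "is_partition a b n t" "is_partition a b n' t'"
  shows "\<exists>m s d. is_partition a b m s \<and>
    step_fun m s d = (\<lambda>x. \<alpha> * step_fun n t c x + \<beta> * step_fun n' t' c' x) \<and>
    step_integral X m s d = (\<lambda>\<omega>. \<alpha> * step_integral X n t c \<omega> + \<beta> * step_integral X n' t' c' \<omega>)"
proof -
  obtain m s d d' where s: "is_partition a b m s"
    and d: "step_fun m s d = step_fun n t c" "step_integral X m s d = step_integral X n t c"
    and d': "step_fun m s d' = step_fun n' t' c'" "step_integral X m s d' = step_integral X n' t' c'"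
    using common_refinement[OF assms] .
  have "step_fun m s (\<lambda>i. \<alpha> * d i + \<beta> * d' i) = (\<lambda>x. \<alpha> * step_fun n t c x + \<beta> * step_fun n' t' c' x)"
    "step_integral X m s (\<lambda>i. \<alpha> * d i + \<beta> * d' i) =
      (\<lambda>\<omega>. \<alpha> * step_integral X n t c \<omega> + \<beta> * step_integral X n' t' c' \<omega>)"
    unfolding step_fun_linear step_integral_linear d d' by (rule refl)+
  with s show ?thesis by blast
qed

text \<open>
  The cells of a partition are disjoint, so at most one term of the sum is nonzero at a given point.
\<close>

lemma step_fun_square:
  assumes t: "is_partition a b n t"
  shows "(step_fun n t c x)\<^sup>2 = step_fun n t (\<lambda>i. (c i)\<^sup>2) x"
proof (cases "\<exists>i\<in>{1..n}. x \<in> {t (i - 1)..<t i}")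
  case True
  then obtain i where i: "i \<in> {1..n}" "x \<in> {t (i - 1)..<t i}" by blast
  have unique: "x \<notin> {t (j - 1)..<t j}" if j: "j \<in> {1..n}" "j \<noteq> i" for j
  proof (cases "j < i")
    case True
    then have "t j \<le> t (i - 1)" using i by (intro is_partition_mono[OF t]) auto
    then show ?thesis using i(2) by auto
  next
    case False
    then have "t i \<le> t (j - 1)" using j by (intro is_partition_mono[OF t]) auto
    then show ?thesis using i(2) by auto
  qed
  have "step_fun n t e x = e i" for e
  proof -
    have "e j * indicator {t (j - 1)..<t j} x = (if j = i then e j else 0)" if "j \<in> {1..n}" for j
      using unique[OF that] i(2)
      by (cases "j = i") (simp_all only: indicator_simps simp_thms if_True if_False mult_1_right mult_zero_right)
    then have "step_fun n t e x = (\<Sum>j=1..n. if j = i then e j else 0)"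
      unfolding step_fun_def by (intro sum.cong refl)
    then show ?thesis using i(1) by (simp only: sum.delta finite_atLeastAtMost if_True)
  qed
  then show ?thesis by simp
next
  case False
  then have "step_fun n t e x = 0" for e
    unfolding step_fun_def by (intro sum.neutral) auto
  then show ?thesis by simp
qed

lemma step_fun_LS_integral:
  assumes F: "LS_integrator a b F" and t: "is_partition a b n t"
  shows "integrable (LS_measure a b F) (step_fun n t c)"
    and "(\<integral>x. step_fun n t c x \<partial>LS_measure a b F) = (\<Sum>i=1..n. c i * (F (t i) - F (t (i - 1))))"
proof -
  interpret finite_measure "LS_measure a b F" by (rule finite_measure_LS_measure[OF F])
  have cell: "a \<le> t (i - 1)" "t (i - 1) \<le> t i" "t i \<le> b" if "i \<in> {1..n}" for i
  proof -
    have "i \<le> n" "i - 1 \<le> n" using that by auto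
    then show "a \<le> t (i - 1)" "t (i - 1) \<le> t i" "t i \<le> b"
      by (simp_all add: is_partition_bounds[OF t] is_partition_mono[OF t])
  qed
  have meas: "{t (i - 1)..<t i} \<in> sets (LS_measure a b F)" if "i \<in> {1..n}" for i
  proof -
    have eq: "{t (i - 1)..<t i} = {a..b} \<inter> {t (i - 1)..<t i}" using cell[OF that] by auto
    show ?thesis
      unfolding sets_LS_measure sets_restrict_space by (rule image_eqI[where x = "{t (i - 1)..<t i}"]) (rule eq, simp)
  qed
  have int: "integrable (LS_measure a b F) (\<lambda>x. c i * indicator {t (i - 1)..<t i} x)"
    if "i \<in> {1..n}" for i
    by (intro integrable_mult_right integrable_real_indicator meas that) (simp add: less_top[symmetric])
  then show "integrable (LS_measure a b F) (step_fun n t c)"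
    unfolding step_fun_def[abs_def] by (intro Bochner_Integration.integrable_sum) auto
  have "(\<integral>x. step_fun n t c x \<partial>LS_measure a b F) =
      (\<Sum>i=1..n. \<integral>x. c i * indicator {t (i - 1)..<t i} x \<partial>LS_measure a b F)"
    unfolding step_fun_def by (rule Bochner_Integration.integral_sum) (rule int)
  also have "\<dots> = (\<Sum>i=1..n. c i * (F (t i) - F (t (i - 1))))"
  proof (intro sum.cong refl)
    fix i assume i: "i \<in> {1..n}"
    then have "{t (i - 1)..<t i} \<inter> {a..b} = {t (i - 1)..<t i}" using cell[OF i] by auto
    then show "(\<integral>x. c i * indicator {t (i - 1)..<t i} x \<partial>LS_measure a b F) = c i * (F (t i) - F (t (i - 1)))"
      using measure_LS_measure_Ico[OF F cell[OF i]] by simp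
  qed
  finally show "(\<integral>x. step_fun n t c x \<partial>LS_measure a b F) = (\<Sum>i=1..n. c i * (F (t i) - F (t (i - 1))))" .
qed

lemma step_fun_L2:
  assumes "LS_integrator a b F" "is_partition a b n t"
  shows "step_fun n t c \<in> L2 (LS_measure a b F)"
  using step_fun_LS_integral(1)[OF assms] step_fun_square[OF assms(2)]
  by (simp add: L2_def borel_measurable_integrable)

definition step_approximable :: "real \<Rightarrow> real \<Rightarrow> (real \<Rightarrow> real) \<Rightarrow> (real \<Rightarrow> real) \<Rightarrow> bool" where
  "step_approximable a b F f \<longleftrightarrow> (\<exists>n t c. (\<forall>k. is_partition a b (n k) (t k)) \<and>
     tendsto_L2 (LS_measure a b F) (\<lambda>k. step_fun (n k) (t k) (c k)) f)"

lemma step_approximable_linear_combination: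
  assumes "step_approximable a b F f" "step_approximable a b F g"
  shows "step_approximable a b F (\<lambda>x. \<alpha> * f x + \<beta> * g x)"
proof -
  obtain n t c where t: "\<And>k. is_partition a b (n k) (t k)"
    and f: "tendsto_L2 (LS_measure a b F) (\<lambda>k. step_fun (n k) (t k) (c k)) f"
    using assms(1) unfolding step_approximable_def by blast
  obtain n' t' c' where t': "\<And>k. is_partition a b (n' k) (t' k)"
    and g: "tendsto_L2 (LS_measure a b F) (\<lambda>k. step_fun (n' k) (t' k) (c' k)) g"
    using assms(2) unfolding step_approximable_def by blast
  have "\<exists>m s d. is_partition a b m s \<and>
      step_fun m s d = (\<lambda>x. \<alpha> * step_fun (n k) (t k) (c k) x + \<beta> * step_fun (n' k) (t' k) (c' k) x)" for k
    using step_fun_linear_combination[OF t t'] by blast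
  then obtain m s d where "\<And>k. is_partition a b (m k) (s k)"
    and "\<And>k. step_fun (m k) (s k) (d k) =
      (\<lambda>x. \<alpha> * step_fun (n k) (t k) (c k) x + \<beta> * step_fun (n' k) (t' k) (c' k) x)"
    by metis
  then show ?thesis
    using tendsto_L2_linear_combination[OF f g, of \<alpha> \<beta>] unfolding step_approximable_def
    by (metis (no_types, lifting) ext)
qed

lemma step_approximable_limit:
  assumes approx: "\<And>k. step_approximable a b F (u k)" and u: "tendsto_L2 (LS_measure a b F) u f"
  shows "step_approximable a b F f"
proof -
  let ?N = "LS_measure a b F"
  have "\<forall>k. \<exists>n t c. is_partition a b n t \<and> step_fun n t c \<in> L2 ?N \<and>
      (\<integral>x. (step_fun n t c x - u k x)\<^sup>2 \<partial>?N) < 1 / real (Suc k)"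
  proof
    fix k
    obtain n t c where t: "\<And>i. is_partition a b (n i) (t i)"
      and lim: "tendsto_L2 ?N (\<lambda>i. step_fun (n i) (t i) (c i)) (u k)"
      using approx[of k] unfolding step_approximable_def by blast
    from lim have "\<forall>\<^sub>F i in sequentially. (\<integral>x. (step_fun (n i) (t i) (c i) x - u k x)\<^sup>2 \<partial>?N) < 1 / real (Suc k)"
      unfolding tendsto_L2_def by (intro order_tendstoD(2)[of _ 0]) auto
    then obtain i where "(\<integral>x. (step_fun (n i) (t i) (c i) x - u k x)\<^sup>2 \<partial>?N) < 1 / real (Suc k)"
      by (auto dest: eventually_happens)
    with t[of i] lim show "\<exists>n t c. is_partition a b n t \<and> step_fun n t c \<in> L2 ?N \<and>
      (\<integral>x. (step_fun n t c x - u k x)\<^sup>2 \<partial>?N) < 1 / real (Suc k)"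
      unfolding tendsto_L2_def by blast
  qed
  then have "\<exists>n t c. \<forall>k. is_partition a b (n k) (t k) \<and> step_fun (n k) (t k) (c k) \<in> L2 ?N \<and>
      (\<integral>x. (step_fun (n k) (t k) (c k) x - u k x)\<^sup>2 \<partial>?N) < 1 / real (Suc k)"
    by (simp only: choice_iff)
  then obtain n t c where t: "\<And>k. is_partition a b (n k) (t k)"
    and L2: "\<And>k. step_fun (n k) (t k) (c k) \<in> L2 ?N"
    and close: "\<And>k. (\<integral>x. (step_fun (n k) (t k) (c k) x - u k x)\<^sup>2 \<partial>?N) < 1 / real (Suc k)"
    by blast
  have "(\<lambda>k. \<integral>x. (step_fun (n k) (t k) (c k) x - u k x)\<^sup>2 \<partial>?N) \<longlonglongrightarrow> 0"
    by (rule tendsto_sandwich[OF _ _ tendsto_const LIMSEQ_inverse_real_of_nat])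
      (use close in \<open>auto intro!: always_eventually less_imp_le simp: inverse_eq_divide\<close>)
  from tendsto_L2_perturb[OF u L2 this] t show ?thesis
    unfolding step_approximable_def by blast
qed

lemma step_approximable_cong_AE:
  assumes "step_approximable a b F f" "AE x in LS_measure a b F. f x = g x" "g \<in> L2 (LS_measure a b F)"
  shows "step_approximable a b F g"
  using assms unfolding step_approximable_def by (blast intro: tendsto_L2_cong_AE)

lemma step_approximable_step_fun:
  assumes "LS_integrator a b F" "is_partition a b n t"
  shows "step_approximable a b F (step_fun n t c)"
  unfolding step_approximable_def
  by (rule exI[of _ "\<lambda>_. n"], rule exI[of _ "\<lambda>_. t"], rule exI[of _ "\<lambda>_. c"])
    (use step_fun_L2[OF assms] assms(2) in \<open>simp add: tendsto_L2_def\<close>)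

text \<open>
  Intervals ending at \<open>x\<close> are step functions up to the null set \<open>{b}\<close>, and approximability is preserved
  by the operations of a Dynkin system.
\<close>

lemma step_approximable_indicator:
  assumes F: "LS_integrator a b F" and A: "A \<in> sets (restrict_space borel {a..b})"
  shows "step_approximable a b F (indicator A)"
  using A
proof (induction rule: borel_interval_induct)
  let ?N = "LS_measure a b F"
  interpret finite_measure ?N by (rule finite_measure_LS_measure[OF F])
  have "a \<le> b" using F by (simp add: LS_integrator_def)
  have L2_indicator: "indicator A \<in> L2 ?N" if "A \<in> sets (restrict_space borel {a..b})" for A
    using that by (auto simp: L2_def sets_LS_measure power2_eq_square indicator_inter_arith[symmetric] less_top[symmetric]
        intro!: integrable_real_indicator)
  have basic: "step_approximable a b F (indicator ({a..b} \<inter> {..<x}))" for x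
  proof -
    \<comment> \<open>the half-open cell \<open>[a, p)\<close> agrees with \<open>[a, b] \<inter> {..<x}\<close> except possibly at \<open>b\<close>\<close>
    define p where "p = max a (min b x)"
    have p: "a \<le> p" "p \<le> b" using \<open>a \<le> b\<close> by (auto simp: p_def)
    obtain m s where s: "is_partition a b m s" "s ` {..m} = {a, p, b}"
      using partition_through_finite_set[of "{a, p, b}" a b] p by auto
    then obtain l where l: "l \<le> m" "s l = p" by (metis atMost_iff imageE insertI1 insertI2)
    have s0: "s 0 = a" using s(1) by (simp add: is_partition_def)
    define c where "c j = (indicator {a..<p} (s (j - 1)) :: real)" for j
    have "step_fun m s c y = indicator {a..<p} y" for y
      using sum_increments_over_interval[OF s(1) _ l(1), of 0 "\<lambda>u. if y < u then 1 else 0"] p(1)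
      by (auto simp: step_fun_eq_step_integral[OF s(1)] step_integral_def c_def l s0 indicator_def)
    then have "step_fun m s c = indicator {a..<p}" by (rule ext)
    with step_approximable_step_fun[OF F s(1), of c]
    have step: "step_approximable a b F (indicator {a..<p})" by simp
    have "AE y in ?N. indicator {a..<p} y = (indicator ({a..b} \<inter> {..<x}) y :: real)"
      using LS_measure_endpoint_null[OF F] AE_space
      by eventually_elim (auto simp: indicator_def p_def)
    then show ?thesis
      by (rule step_approximable_cong_AE[OF step]) (auto intro!: L2_indicator simp: sets_restrict_space)
  qed
  then show "step_approximable a b F (indicator ({a..b} \<inter> {..<x}))" for x .
  have "{a..b} \<inter> {..<a} = {}" "{a..b} \<inter> {..<b + 1} = {a..b}" by auto
  with basic[of a] basic[of "b + 1"]
  have empty: "step_approximable a b F (indicator {})"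
    and all: "step_approximable a b F (indicator {a..b})" by simp_all
  show "step_approximable a b F (indicator {})" by (rule empty)
  show "step_approximable a b F (indicator ({a..b} - A))"
    if "A \<in> sets (restrict_space borel {a..b})" "step_approximable a b F (indicator A)" for A
  proof -
    have "A \<subseteq> {a..b}" using sets.sets_into_space[OF that(1)] by (simp add: space_restrict_space)
    then have "indicator ({a..b} - A) = (\<lambda>x. 1 * indicator {a..b} x + (-1) * indicator A x :: real)"
      by (auto simp: fun_eq_iff indicator_def)
    then show ?thesis
      using step_approximable_linear_combination[OF all that(2), of 1 "-1"] by simp
  qed
  show "step_approximable a b F (indicator (\<Union>i. A i))"
    if disj: "disjoint_family A" and sets: "range A \<subseteq> sets (restrict_space borel {a..b})"
      and approx: "\<And>i. step_approximable a b F (indicator (A i))" for A :: "nat \<Rightarrow> real set"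
  proof (rule step_approximable_limit)
    show "step_approximable a b F (indicator (\<Union>i<k. A i))" for k
    proof (induction k)
      case 0
      show ?case by (simp only: lessThan_0 UN_empty empty)
    next
      case (Suc k)
      have "A k \<inter> A i = {}" if "i < k" for i
        using disj that by (simp add: disjoint_family_on_def)
      then have "A k \<inter> (\<Union>i<k. A i) = {}" by blast
      then have "indicator (\<Union>i<Suc k. A i) =
          (\<lambda>x. 1 * indicator (A k) x + 1 * indicator (\<Union>i<k. A i) x :: real)"
        by (auto simp: fun_eq_iff indicator_def lessThan_Suc)
      then show ?case
        using step_approximable_linear_combination[OF approx[of k] Suc, of 1 1] by simp
    qed
    show "tendsto_L2 ?N (\<lambda>k. indicator (\<Union>i<k. A i)) (indicator (\<Union>i. A i))"
    proof (rule tendsto_L2_dominated[where g = "\<lambda>_. 1"])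
      show "indicator (\<Union>i<k. A i) \<in> borel_measurable ?N" for k
        using sets by (intro borel_measurable_indicator) (auto simp: sets_LS_measure)
      show "(\<lambda>k. indicator (\<Union>i<k. A i) x :: real) \<longlonglongrightarrow> indicator (\<Union>i. A i) x" for x
        by (rule LIMSEQ_indicator_UN)
    qed (auto simp: L2_def indicator_def)
  qed
qed

lemma L2_step_approximable:
  assumes F: "LS_integrator a b F" and f: "f \<in> L2 (LS_measure a b F)"
  shows "step_approximable a b F f"
proof -
  let ?N = "LS_measure a b F"
  interpret finite_measure ?N by (rule finite_measure_LS_measure[OF F])
  have f_meas: "f \<in> borel_measurable ?N" using f by (simp add: L2_def)
  obtain u where u: "\<And>k. simple_function ?N (u k)"
    and lim: "\<And>x. x \<in> space ?N \<Longrightarrow> (\<lambda>k. u k x) \<longlonglongrightarrow> f x"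
    and dist: "\<And>k x. x \<in> space ?N \<Longrightarrow> dist (u k x) 0 \<le> 2 * dist (f x) 0"
    using borel_measurable_implies_sequence_metric[OF f_meas, of 0] by blast
  have bound: "\<bar>u k x\<bar> \<le> \<bar>2 * f x\<bar>" if "x \<in> space ?N" for k x
    using dist[OF that, of k] by (simp add: dist_real_def)
  have "(\<lambda>x. 2 * f x) \<in> L2 ?N" using L2_linear_combination(1)[OF f f, of 2 0] by simp
  then have tendsto: "tendsto_L2 ?N u f"
    using u bound lim
    by (intro tendsto_L2_dominated[where g = "\<lambda>x. 2 * f x"]) (auto intro: borel_measurable_simple_function)
  show ?thesis
  proof (rule step_approximable_limit[OF _ tendsto])
    fix k
    let ?R = "u k ` space ?N"
    have "finite ?R" using u by (simp add: simple_function_def)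
    have sets: "u k -` {y} \<inter> space ?N \<in> sets (restrict_space borel {a..b})" for y
      using simple_functionD(2)[OF u[of k], of "{y}"] by (simp add: sets_LS_measure)
    have sum: "step_approximable a b F (\<lambda>x. \<Sum>y\<in>R. y * indicator (u k -` {y} \<inter> space ?N) x)"
      if "finite R" for R
      using that
    proof (induction R)
      case empty
      have zero: "(\<lambda>x. \<Sum>y\<in>{}. y * indicator (u k -` {y} \<inter> space ?N) x) = (indicator {} :: real \<Rightarrow> real)"
        by (simp add: fun_eq_iff)
      show ?case unfolding zero by (rule step_approximable_indicator[OF F]) simp
    next
      case (insert y R)
      show ?case
        using step_approximable_linear_combination[OF step_approximable_indicator[OF F sets[of y]] insert.IH, of y 1]
        by (simp only: sum.insert[OF insert.hyps] mult_1)
    qed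
    have rep: "(\<Sum>y\<in>?R. y * indicator (u k -` {y} \<inter> space ?N) x) = u k x" if "x \<in> space ?N" for x
      unfolding simple_function_indicator_representation_banach[OF u[of k] that]
      by (intro sum.cong refl) (simp only: real_scaleR_def mult.commute)
    have "AE x in ?N. (\<Sum>y\<in>?R. y * indicator (u k -` {y} \<inter> space ?N) x) = u k x"
      by (intro AE_I2 rep)
    from step_approximable_cong_AE[OF sum[OF \<open>finite ?R\<close>] this] tendsto
    show "step_approximable a b F (u k)" by (simp add: tendsto_L2_def)
  qed
qed

section \<open>Normal laws\<close>

lemma normal_law_eq_affine_std_normal:
  assumes "0 < v"
  shows "normal_law \<mu> v = distr std_normal_distribution borel (\<lambda>x. \<mu> + sqrt v * x)"
proof -
  interpret prob_space std_normal_distribution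
    by (rule prob_space_normal_density) simp
  have "distributed std_normal_distribution lborel (\<lambda>x. x) std_normal_density"
    by (auto simp: distributed_def distr_id2)
  from normal_density_affine[OF this, of "sqrt v" \<mu>] assms
  have "distributed std_normal_distribution lborel (\<lambda>x. \<mu> + sqrt v * x) (normal_density \<mu> (sqrt v))"
    by simp
  from distributed_distr_eq_density[OF this]
  have "distr std_normal_distribution lborel (\<lambda>x. \<mu> + sqrt v * x) = normal_law \<mu> v"
    using assms by (simp add: normal_law_def)
  moreover have "distr std_normal_distribution lborel (\<lambda>x. \<mu> + sqrt v * x) =
      distr std_normal_distribution borel (\<lambda>x. \<mu> + sqrt v * x)"
    by (rule distr_cong) simp_all
  ultimately show ?thesis by simp
qed

lemma real_distribution_normal_law:
  assumes "0 \<le> v"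
  shows "real_distribution (normal_law \<mu> v)"
proof -
  have "prob_space (normal_law \<mu> v)"
    unfolding normal_law_def using assms
    by (auto intro!: prob_space_return prob_space_normal_density)
  moreover have "sets (normal_law \<mu> v) = sets borel"
    by (simp add: normal_law_def)
  ultimately show ?thesis
    by (intro real_distribution.intro real_distribution_axioms.intro) simp_all
qed

lemma char_normal_law:
  assumes "0 \<le> v"
  shows "char (normal_law \<mu> v) t = iexp (t * \<mu>) * complex_of_real (exp (- (v * t\<^sup>2) / 2))"
proof (cases "v = 0")
  case True
  then show ?thesis by (simp add: normal_law_def char_def integral_return)
next
  case False
  with assms have "0 < v" by simp
  have "char (normal_law \<mu> v) t = (CLINT x|std_normal_distribution. iexp (t * (\<mu> + sqrt v * x)))"
    unfolding normal_law_eq_affine_std_normal[OF \<open>0 < v\<close>] char_def by (subst integral_distr) simp_all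
  also have "\<dots> = (CLINT x|std_normal_distribution. iexp (t * \<mu>) * iexp ((t * sqrt v) * x))"
    by (intro Bochner_Integration.integral_cong refl) (simp add: algebra_simps flip: exp_add)
  also have "\<dots> = iexp (t * \<mu>) * char std_normal_distribution (t * sqrt v)"
    by (simp add: char_def)
  also have "(t * sqrt v)\<^sup>2 = v * t\<^sup>2" using assms by (simp add: power_mult_distrib)
  then have "char std_normal_distribution (t * sqrt v) = complex_of_real (exp (- (v * t\<^sup>2) / 2))"
    unfolding char_std_normal_distribution by simp
  finally show ?thesis .
qed

lemma normal_law_moments:
  assumes "0 \<le> v"
  shows "has_bochner_integral (normal_law \<mu> v) (\<lambda>x. x) \<mu>"
    and "has_bochner_integral (normal_law \<mu> v) (\<lambda>x. x\<^sup>2) (v + \<mu>\<^sup>2)"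
proof -
  have "has_bochner_integral (normal_law \<mu> v) (\<lambda>x. x) \<mu> \<and>
    has_bochner_integral (normal_law \<mu> v) (\<lambda>x. x\<^sup>2) (v + \<mu>\<^sup>2)"
  proof (cases "v = 0")
    case True
    then show ?thesis
      by (auto simp: normal_law_def has_bochner_integral_iff integral_return integrable_iff_bounded nn_integral_return)
  next
    case False
    with assms have "0 < v" by simp
    then have "0 < sqrt v" by simp
    note first = normal_moment_nz_1[OF this, of \<mu>]
      and zeroth = normal_moment_even[OF this, of \<mu> 0]
      and second = normal_moment_even[OF this, of \<mu> 1]
    have "has_bochner_integral lborel (\<lambda>x. normal_density \<mu> (sqrt v) x * (x - \<mu>) ^ 2
        + 2 * \<mu> * (normal_density \<mu> (sqrt v) x * x) - \<mu>\<^sup>2 * normal_density \<mu> (sqrt v) x)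
        (v + 2 * \<mu> * \<mu> - \<mu>\<^sup>2 * 1)"
      using zeroth second first \<open>0 < v\<close>
      by (intro has_bochner_integral_add has_bochner_integral_diff has_bochner_integral_mult_right) simp_all
    also have "(\<lambda>x. normal_density \<mu> (sqrt v) x * (x - \<mu>) ^ 2
        + 2 * \<mu> * (normal_density \<mu> (sqrt v) x * x) - \<mu>\<^sup>2 * normal_density \<mu> (sqrt v) x) =
        (\<lambda>x. normal_density \<mu> (sqrt v) x * x\<^sup>2)"
      by (simp add: fun_eq_iff power2_eq_square algebra_simps)
    also have "v + 2 * \<mu> * \<mu> - \<mu>\<^sup>2 * 1 = v + \<mu>\<^sup>2" by (simp add: power2_eq_square)
    finally show ?thesis
      using first False by (simp add: normal_law_def has_bochner_integral_density)
  qed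
  then show "has_bochner_integral (normal_law \<mu> v) (\<lambda>x. x) \<mu>"
    "has_bochner_integral (normal_law \<mu> v) (\<lambda>x. x\<^sup>2) (v + \<mu>\<^sup>2)" by auto
qed

context prob_space
begin

lemma normal_law_random_variable:
  assumes [measurable]: "Y \<in> borel_measurable M" and law: "distr M borel Y = normal_law \<mu> v" and "0 \<le> v"
  shows "Y \<in> L2 M" "expectation Y = \<mu>" "expectation (\<lambda>\<omega>. (Y \<omega>)\<^sup>2) = v + \<mu>\<^sup>2"
proof -
  note moments = normal_law_moments[OF \<open>0 \<le> v\<close>, of \<mu>, folded law]
  have "integrable M (\<lambda>\<omega>. (Y \<omega>)\<^sup>2)"
    using moments(2) by (simp add: has_bochner_integral_iff integrable_distr_eq)
  then show "Y \<in> L2 M" by (simp add: L2_def)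
  show "expectation Y = \<mu>" "expectation (\<lambda>\<omega>. (Y \<omega>)\<^sup>2) = v + \<mu>\<^sup>2"
    using moments by (simp_all add: has_bochner_integral_iff integral_distr)
qed

text \<open>
  The characteristic function has the same form for the degenerate law, so no case distinction on
  \<open>v = 0\<close> is left for the later proofs.
\<close>

lemma distr_eq_normal_lawI:
  assumes [measurable]: "Y \<in> borel_measurable M" and "0 \<le> v"
    and char: "\<And>t. char (distr M borel Y) t = iexp (t * \<mu>) * complex_of_real (exp (- (v * t\<^sup>2) / 2))"
  shows "distr M borel Y = normal_law \<mu> v"
proof (rule Levy_uniqueness)
  show "real_distribution (distr M borel Y)" by (rule real_distribution_distr) measurable
  show "real_distribution (normal_law \<mu> v)" by (rule real_distribution_normal_law[OF \<open>0 \<le> v\<close>])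
  show "char (distr M borel Y) = char (normal_law \<mu> v)"
    by (rule ext) (simp only: char char_normal_law[OF \<open>0 \<le> v\<close>])
qed

lemma char_distr:
  assumes "Y \<in> borel_measurable M"
  shows "char (distr M borel Y) t = (CLINT \<omega>|M. iexp (t * Y \<omega>))"
  using assms by (simp add: char_def integral_distr)

lemma distr_sum_indep_normal_law:
  assumes indep: "indep_vars (\<lambda>_. borel) Y I" and "finite I"
    and law: "\<And>i. i \<in> I \<Longrightarrow> distr M borel (Y i) = normal_law (m i) (v i)"
    and v: "\<And>i. i \<in> I \<Longrightarrow> 0 \<le> v i"
  shows "distr M borel (\<lambda>\<omega>. \<Sum>i\<in>I. c i * Y i \<omega>) = normal_law (\<Sum>i\<in>I. c i * m i) (\<Sum>i\<in>I. (c i)\<^sup>2 * v i)"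
proof (rule distr_eq_normal_lawI)
  have Y: "Y i \<in> borel_measurable M" if "i \<in> I" for i
    using indep that by (auto simp: indep_vars_def2)
  then show "(\<lambda>\<omega>. \<Sum>i\<in>I. c i * Y i \<omega>) \<in> borel_measurable M" by measurable
  show "0 \<le> (\<Sum>i\<in>I. (c i)\<^sup>2 * v i)" using v by (intro sum_nonneg) auto
  fix t
  have "indep_vars (\<lambda>_. borel) (\<lambda>i \<omega>. c i * Y i \<omega>) I"
    by (rule indep_vars_compose2[OF indep]) measurable
  then have "char (distr M borel (\<lambda>\<omega>. \<Sum>i\<in>I. c i * Y i \<omega>)) t =
      (\<Prod>i\<in>I. char (distr M borel (\<lambda>\<omega>. c i * Y i \<omega>)) t)"
    by (rule char_distr_sum)
  also have "\<dots> = (\<Prod>i\<in>I. exp (\<i> * of_real (t * (c i * m i)) + of_real (- ((c i)\<^sup>2 * v i * t\<^sup>2) / 2)))"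
  proof (rule prod.cong[OF refl])
    fix i assume i: "i \<in> I"
    have "char (distr M borel (\<lambda>\<omega>. c i * Y i \<omega>)) t = char (distr M borel (Y i)) (t * c i)"
      using Y[OF i] by (subst (1 2) char_distr) (simp_all add: mult.assoc)
    also have "\<dots> = iexp (t * c i * m i) * complex_of_real (exp (- (v i * (t * c i)\<^sup>2) / 2))"
      unfolding law[OF i] by (rule char_normal_law[OF v[OF i]])
    also have "\<dots> = exp (\<i> * of_real (t * (c i * m i)) + of_real (- ((c i)\<^sup>2 * v i * t\<^sup>2) / 2))"
      by (simp only: exp_add exp_of_real) (simp add: power_mult_distrib mult_ac)
    finally show "char (distr M borel (\<lambda>\<omega>. c i * Y i \<omega>)) t =
      exp (\<i> * of_real (t * (c i * m i)) + of_real (- ((c i)\<^sup>2 * v i * t\<^sup>2) / 2))" .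
  qed
  also have "\<dots> = exp (\<Sum>i\<in>I. \<i> * of_real (t * (c i * m i)) + of_real (- ((c i)\<^sup>2 * v i * t\<^sup>2) / 2))"
    by (rule exp_sum[OF \<open>finite I\<close>, symmetric])
  also have "(\<Sum>i\<in>I. \<i> * of_real (t * (c i * m i)) + of_real (- ((c i)\<^sup>2 * v i * t\<^sup>2) / 2)) =
      \<i> * of_real (t * (\<Sum>i\<in>I. c i * m i)) + of_real (- ((\<Sum>i\<in>I. (c i)\<^sup>2 * v i) * t\<^sup>2) / 2)"
    by (simp add: sum.distrib sum_distrib_left sum_distrib_right sum_subtractf sum_negf sum_divide_distrib)
  also have "exp \<dots> = iexp (t * (\<Sum>i\<in>I. c i * m i)) *
      complex_of_real (exp (- ((\<Sum>i\<in>I. (c i)\<^sup>2 * v i) * t\<^sup>2) / 2))"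
    by (simp only: exp_add exp_of_real)
  finally show "char (distr M borel (\<lambda>\<omega>. \<Sum>i\<in>I. c i * Y i \<omega>)) t =
      iexp (t * (\<Sum>i\<in>I. c i * m i)) * complex_of_real (exp (- ((\<Sum>i\<in>I. (c i)\<^sup>2 * v i) * t\<^sup>2) / 2))" .
qed

text \<open>
  Characteristic functions are Lipschitz in the random variable for the \<open>L\<^sup>1\<close>-norm, so they converge
  along an \<open>L\<^sup>2\<close>-convergent sequence; the limit of the Gaussian ones is again Gaussian, possibly
  degenerate.
\<close>

lemma tendsto_L2_normal_law:
  assumes lim: "tendsto_L2 M Y Z"
    and law: "\<And>k. distr M borel (Y k) = normal_law (m k) (v k)" and v_nonneg: "\<And>k. 0 \<le> v k"
    and m: "m \<longlonglongrightarrow> \<mu>" and v: "v \<longlonglongrightarrow> \<sigma>"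
  shows "distr M borel Z = normal_law \<mu> \<sigma>"
proof (rule distr_eq_normal_lawI)
  have L2: "Y k \<in> L2 M" "Z \<in> L2 M" for k using lim by (auto simp: tendsto_L2_def)
  then have meas [measurable]: "Y k \<in> borel_measurable M" "Z \<in> borel_measurable M" for k
    by (auto simp: L2_def)
  show "Z \<in> borel_measurable M" by measurable
  show "0 \<le> \<sigma>" by (rule LIMSEQ_le_const[OF v]) (use v_nonneg in auto)
  fix t
  let ?D = "\<lambda>k. expectation (\<lambda>\<omega>. (Y k \<omega> - Z \<omega>)\<^sup>2)"
  have "(\<lambda>k. \<bar>t\<bar> * sqrt (?D k)) \<longlonglongrightarrow> \<bar>t\<bar> * sqrt 0"
    using lim unfolding tendsto_L2_def by (intro tendsto_intros) auto
  then have null: "(\<lambda>k. \<bar>t\<bar> * sqrt (?D k)) \<longlonglongrightarrow> 0" by simp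
  have bound: "norm (char (distr M borel (Y k)) t - char (distr M borel Z) t) \<le> \<bar>t\<bar> * sqrt (?D k)" for k
  proof -
    have abs_L2: "(\<lambda>\<omega>. \<bar>Y k \<omega> - Z \<omega>\<bar>) \<in> L2 M"
      using L2_diff[OF L2(1)[of k] L2(2)] by (simp add: L2_def)
    have Lipschitz: "norm (iexp (t * Y k \<omega>) - iexp (t * Z \<omega>)) \<le> \<bar>t\<bar> * \<bar>Y k \<omega> - Z \<omega>\<bar>" for \<omega>
    proof -
      let ?z = "t * Y k \<omega> - t * Z \<omega>"
      have "iexp (t * Y k \<omega>) - iexp (t * Z \<omega>) = iexp (t * Z \<omega>) * (iexp ?z - 1)"
        by (simp add: algebra_simps flip: exp_add)
      then have "norm (iexp (t * Y k \<omega>) - iexp (t * Z \<omega>)) = norm (iexp ?z - 1)"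
        by (simp only: norm_mult norm_exp_i_times mult_1)
      also have "\<dots> \<le> \<bar>?z\<bar>" using iexp_approx1[of ?z 0] by simp
      also have "\<dots> = \<bar>t\<bar> * \<bar>Y k \<omega> - Z \<omega>\<bar>" by (simp add: abs_mult flip: right_diff_distrib)
      finally show ?thesis .
    qed
    have "char (distr M borel (Y k)) t - char (distr M borel Z) t =
        (CLINT \<omega>|M. iexp (t * Y k \<omega>) - iexp (t * Z \<omega>))"
      by (simp add: char_distr integrable_iexp)
    also have "norm \<dots> \<le> (\<integral>\<omega>. \<bar>t\<bar> * \<bar>Y k \<omega> - Z \<omega>\<bar> \<partial>M)"
      using L2_integrable(1)[OF abs_L2]
      by (intro order.trans[OF integral_norm_bound integral_mono] Lipschitz) (auto simp: integrable_iexp)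
    also have "\<dots> = \<bar>t\<bar> * expectation (\<lambda>\<omega>. \<bar>Y k \<omega> - Z \<omega>\<bar>)" by simp
    also have "\<dots> \<le> \<bar>t\<bar> * sqrt (?D k)"
      using L2_integrable(2)[OF abs_L2]
      by (intro mult_left_mono real_le_rsqrt) (simp_all add: prob_space)
    finally show ?thesis .
  qed
  have "(\<lambda>k. char (distr M borel (Y k)) t - char (distr M borel Z) t) \<longlonglongrightarrow> 0"
    by (rule Lim_null_comparison[OF always_eventually null]) (intro allI bound)
  then have "(\<lambda>k. char (distr M borel (Y k)) t) \<longlonglongrightarrow> char (distr M borel Z) t"
    by (simp only: LIM_zero_iff)
  moreover have "(\<lambda>k. char (distr M borel (Y k)) t) \<longlonglongrightarrow>
      iexp (t * \<mu>) * complex_of_real (exp (- (\<sigma> * t\<^sup>2) / 2))"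
    unfolding law char_normal_law[OF v_nonneg] by (intro tendsto_intros m v) simp
  ultimately show "char (distr M borel Z) t = iexp (t * \<mu>) * complex_of_real (exp (- (\<sigma> * t\<^sup>2) / 2))"
    by (rule LIMSEQ_unique)
qed

end

section \<open>The Wiener integral\<close>

lemma LS_integrator_total_variation:
  assumes "a \<le> b" and cont: "continuous_on {a..b} F" and bv: "bounded_variation_on a b F"
  shows "LS_integrator a b (total_variation a F)"
    and "LS_integrator a b (\<lambda>t. (total_variation a F t + F t) / 2)"
    and "LS_integrator a b (\<lambda>t. (total_variation a F t - F t) / 2)"
proof -
  let ?V = "total_variation a F"
  have "continuous_on {a..b} ?V" by (rule continuous_on_total_variation[OF bv cont \<open>a \<le> b\<close>])
  then have conts: "continuous_on {a..b} ?V" "continuous_on {a..b} (\<lambda>t. (?V t + F t) / 2)"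
    "continuous_on {a..b} (\<lambda>t. (?V t - F t) / 2)"
    using cont by (auto intro!: continuous_intros)
  have incr: "\<bar>F y - F x\<bar> \<le> ?V y - ?V x" if "x \<in> {a..b}" "y \<in> {a..b}" "x \<le> y" for x y
    using total_variation_increment[OF bv, of x y] that by simp
  have "mono_on {a..b} ?V" "mono_on {a..b} (\<lambda>t. (?V t + F t) / 2)" "mono_on {a..b} (\<lambda>t. (?V t - F t) / 2)"
    by (rule mono_onI, use incr in fastforce)+
  with conts \<open>a \<le> b\<close>
  show "LS_integrator a b ?V" "LS_integrator a b (\<lambda>t. (?V t + F t) / 2)"
    "LS_integrator a b (\<lambda>t. (?V t - F t) / 2)"
    by (auto simp: LS_integrator_def)
qed

lemma L2_LS_measure_dominated:
  assumes F: "LS_integrator a b F" and G: "LS_integrator a b G" and f: "f \<in> L2 (LS_measure a b (\<lambda>t. F t + G t))"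
  shows "f \<in> L2 (LS_measure a b F)"
    and "(\<integral>x. (f x)\<^sup>2 \<partial>LS_measure a b F) \<le> (\<integral>x. (f x)\<^sup>2 \<partial>LS_measure a b (\<lambda>t. F t + G t))"
  using integrable_LS_measure_dominated[OF F G, of "\<lambda>x. (f x)\<^sup>2"] f
  by (auto simp: L2_def sets_LS_measure cong: measurable_cong_sets)

lemma tendsto_L2_LS_measure_dominated:
  assumes F: "LS_integrator a b F" and G: "LS_integrator a b G"
    and lim: "tendsto_L2 (LS_measure a b (\<lambda>t. F t + G t)) u f"
  shows "tendsto_L2 (LS_measure a b F) u f"
proof -
  let ?N = "LS_measure a b (\<lambda>t. F t + G t)"
  have L2: "u k \<in> L2 ?N" "f \<in> L2 ?N" for k using lim by (auto simp: tendsto_L2_def)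
  have null: "(\<lambda>k. \<integral>x. (u k x - f x)\<^sup>2 \<partial>?N) \<longlonglongrightarrow> 0" using lim by (simp add: tendsto_L2_def)
  have "(\<lambda>k. \<integral>x. (u k x - f x)\<^sup>2 \<partial>LS_measure a b F) \<longlonglongrightarrow> 0"
    by (rule tendsto_sandwich[OF _ _ tendsto_const null])
      (intro always_eventually allI integral_nonneg_AE AE_I2 zero_le_power2
        L2_LS_measure_dominated(2)[OF F G] L2_diff L2)+
  then show ?thesis
    using L2_LS_measure_dominated(1)[OF F G] L2 by (simp add: tendsto_L2_def)
qed

locale yeh_process_on_interval = prob_space M for M :: "'w measure" +
  fixes X :: "real \<Rightarrow> 'w \<Rightarrow> real" and a b :: real and lam rho :: "real \<Rightarrow> real"
  assumes standing: "standing_assumptions a b lam rho"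
    and yeh: "yeh_process M X a b lam rho"
begin

abbreviation "\<nu> \<equiv> measure_lam_rho a b lam rho"
abbreviation "pos_var \<equiv> \<lambda>t. (total_variation a lam t + lam t) / 2"
abbreviation "neg_var \<equiv> \<lambda>t. (total_variation a lam t - lam t) / 2"
abbreviation "mean f \<equiv> LS_integral a b lam f"
abbreviation "energy f \<equiv> \<integral>x. (f x)\<^sup>2 \<partial>LS_measure a b rho"
abbreviation "I f \<equiv> wiener_integral M X a b lam rho f"

lemma integrators:
  shows integrator_rho: "LS_integrator a b rho"
    and integrator_tv: "LS_integrator a b (total_variation a lam)"
    and integrator_pos: "LS_integrator a b pos_var"
    and integrator_neg: "LS_integrator a b neg_var"
  using standing LS_integrator_total_variation[of a b lam]
  by (auto simp: standing_assumptions_def LS_integrator_def)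

lemma integrator_nu: "LS_integrator a b (\<lambda>t. rho t + total_variation a lam t)"
  by (rule LS_integrator_add[OF integrator_rho integrator_tv])

lemma nu_eq_rho: "\<nu> = LS_measure a b (\<lambda>t. rho t + total_variation a lam t)"
  by (simp add: measure_lam_rho_def)

text \<open>
  Since \<open>|\<lambda>|\<close> is the sum of the two Jordan components of \<open>\<lambda>\<close>, the measure \<open>\<nu>\<close> can be split with
  either of them as a summand, and hence dominates it.
\<close>

lemma nu_eq_pos: "\<nu> = LS_measure a b (\<lambda>t. pos_var t + (neg_var t + rho t))"
  unfolding measure_lam_rho_def by (intro arg_cong[where f = "LS_measure a b"] ext) (simp add: field_simps)

lemma nu_eq_neg: "\<nu> = LS_measure a b (\<lambda>t. neg_var t + (pos_var t + rho t))"
  unfolding measure_lam_rho_def by (intro arg_cong[where f = "LS_measure a b"] ext) (simp add: field_simps)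

lemma integrator_neg_rho: "LS_integrator a b (\<lambda>t. neg_var t + rho t)"
  and integrator_pos_rho: "LS_integrator a b (\<lambda>t. pos_var t + rho t)"
  by (intro LS_integrator_add integrators)+

lemmas L2_rho = L2_LS_measure_dominated[OF integrator_rho integrator_tv, folded nu_eq_rho]
lemmas L2_pos = L2_LS_measure_dominated[OF integrator_pos integrator_neg_rho, folded nu_eq_pos]
lemmas L2_neg = L2_LS_measure_dominated[OF integrator_neg integrator_pos_rho, folded nu_eq_neg]
lemmas tendsto_rho = tendsto_L2_LS_measure_dominated[OF integrator_rho integrator_tv, folded nu_eq_rho]
lemmas tendsto_pos = tendsto_L2_LS_measure_dominated[OF integrator_pos integrator_neg_rho, folded nu_eq_pos]
lemmas tendsto_neg = tendsto_L2_LS_measure_dominated[OF integrator_neg integrator_pos_rho, folded nu_eq_neg]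

text \<open>
  A nonnegative function is integrable for the sum of two measures if and only if it is integrable
  for both.
\<close>

lemma L2_lam_rho_eq_L2_nu: "L2_lam_rho a b lam rho = L2 \<nu>"
proof (intro set_eqI iffI)
  fix f assume "f \<in> L2_lam_rho a b lam rho"
  then show "f \<in> L2 \<nu>"
    unfolding nu_eq_rho
    using integrable_LS_measure_add[OF integrator_rho integrator_tv, of "\<lambda>x. (f x)\<^sup>2"]
    by (auto simp: L2_lam_rho_def L2_def sets_LS_measure cong: measurable_cong_sets)
next
  fix f assume f: "f \<in> L2 \<nu>"
  have "\<nu> = LS_measure a b (\<lambda>t. total_variation a lam t + rho t)"
    by (simp add: nu_eq_rho add.commute)
  from L2_LS_measure_dominated(1)[OF integrator_tv integrator_rho, folded this, OF f] L2_rho(1)[OF f]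
  show "f \<in> L2_lam_rho a b lam rho" by (simp add: L2_lam_rho_def L2_def)
qed

sublocale pos: finite_measure "LS_measure a b pos_var"
  by (rule finite_measure_LS_measure[OF integrator_pos])

sublocale neg: finite_measure "LS_measure a b neg_var"
  by (rule finite_measure_LS_measure[OF integrator_neg])

lemma mean_linear_combination:
  assumes "f \<in> L2 \<nu>" "g \<in> L2 \<nu>"
  shows "mean (\<lambda>x. \<alpha> * f x + \<beta> * g x) = \<alpha> * mean f + \<beta> * mean g"
  using pos.L2_integrable(1)[OF L2_pos(1)] neg.L2_integrable(1)[OF L2_neg(1)] assms
  by (simp add: LS_integral_def algebra_simps)

lemma mean_tendsto:
  assumes "tendsto_L2 \<nu> u f"
  shows "(\<lambda>k. mean (u k)) \<longlonglongrightarrow> mean f"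
  unfolding LS_integral_def
  by (intro tendsto_diff pos.tendsto_L2_integral neg.tendsto_L2_integral tendsto_pos tendsto_neg assms)

lemma energy_tendsto:
  assumes "tendsto_L2 \<nu> u f"
  shows "(\<lambda>k. energy (u k)) \<longlonglongrightarrow> energy f"
  by (rule tendsto_L2_integral_square[OF tendsto_rho[OF assms]])

text \<open>
  A bound for the squared norm of \<open>I\<close> as an operator from \<open>L\<^sup>2 \<nu>\<close> to \<open>L\<^sup>2 M\<close>: the term \<open>1\<close> comes from
  \<open>\<integral>f\<^sup>2 d\<rho>\<close>, the masses of the Jordan components from \<open>(\<integral>f d\<lambda>)\<^sup>2\<close>, and the factor \<open>2\<close> from
  \<open>(x - y)\<^sup>2 \<le> 2 x\<^sup>2 + 2 y\<^sup>2\<close>.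
\<close>

definition "bound_const = 1 + 2 * (measure (LS_measure a b pos_var) {a..b} + measure (LS_measure a b neg_var) {a..b})"

lemma bound_const_pos: "0 < bound_const"
  by (simp add: bound_const_def add_pos_nonneg)

lemma energy_mean_bound:
  assumes f: "f \<in> L2 \<nu>"
  shows "energy f + (mean f)\<^sup>2 \<le> bound_const * (\<integral>x. (f x)\<^sup>2 \<partial>\<nu>)"
proof -
  let ?P = "\<integral>x. f x \<partial>LS_measure a b pos_var" and ?N = "\<integral>x. f x \<partial>LS_measure a b neg_var"
  let ?E = "\<integral>x. (f x)\<^sup>2 \<partial>\<nu>"
  let ?p = "measure (LS_measure a b pos_var) {a..b}" and ?n = "measure (LS_measure a b neg_var) {a..b}"
  have "?P\<^sup>2 \<le> ?p * ?E"
    using pos.L2_integrable(2)[OF L2_pos(1)[OF f]] L2_pos(2)[OF f]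
    by (simp add: order.trans[OF _ mult_left_mono])
  moreover have "?N\<^sup>2 \<le> ?n * ?E"
    using neg.L2_integrable(2)[OF L2_neg(1)[OF f]] L2_neg(2)[OF f]
    by (simp add: order.trans[OF _ mult_left_mono])
  moreover have "(?P - ?N)\<^sup>2 \<le> 2 * ?P\<^sup>2 + 2 * ?N\<^sup>2"
    using zero_le_power2[of "?P + ?N"] by (simp add: power2_eq_square algebra_simps)
  moreover have "energy f \<le> ?E" by (rule L2_rho(2)[OF f])
  ultimately show ?thesis
    by (simp add: LS_integral_def bound_const_def algebra_simps)
qed

lemma step_fun_L2_nu: "is_partition a b n t \<Longrightarrow> step_fun n t c \<in> L2 \<nu>"
  unfolding nu_eq_rho by (rule step_fun_L2[OF integrator_nu])

text \<open>
  The increments over the cells of \<open>t\<close> are independent with known normal laws, and the sums of their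
  means and variances, weighted by the values of \<open>f\<close> and their squares, are integrals of \<open>f\<close> and \<open>f\<^sup>2\<close>.
\<close>

lemma step_integral_law:
  assumes t: "is_partition a b n t"
  shows "step_integral X n t c \<in> borel_measurable M"
    and "distr M borel (step_integral X n t c) = normal_law (mean (step_fun n t c)) (energy (step_fun n t c))"
proof -
  let ?Y = "\<lambda>i \<omega>. X (t i) \<omega> - X (t (i - 1)) \<omega>"
  have indices: "i \<le> n" "i - 1 \<le> n" "t (i - 1) < t i" if "i \<in> {1..n}" for i
    using that t by (auto simp: is_partition_def)
  have X: "X s \<in> borel_measurable M" if "a \<le> s" "s \<le> b" for s
    using yeh that by (simp add: yeh_process_def)
  show "step_integral X n t c \<in> borel_measurable M"
    unfolding step_integral_def[abs_def]
    by (intro borel_measurable_sum borel_measurable_times borel_measurable_diff borel_measurable_const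
        X is_partition_bounds[OF t] indices)
  have "indep_vars (\<lambda>_. borel) ?Y {1..n}"
    using yeh t unfolding yeh_process_def by blast
  moreover have "distr M borel (?Y i) = normal_law (lam (t i) - lam (t (i - 1))) (rho (t i) - rho (t (i - 1)))"
    if "i \<in> {1..n}" for i
    using yeh indices(3)[OF that] is_partition_bounds[OF t indices(1)[OF that]]
      is_partition_bounds[OF t indices(2)[OF that]] unfolding yeh_process_def by blast
  moreover have "0 \<le> rho (t i) - rho (t (i - 1))" if "i \<in> {1..n}" for i
    using integrator_rho indices(3)[OF that] is_partition_bounds[OF t indices(1)[OF that]]
      is_partition_bounds[OF t indices(2)[OF that]]
    by (simp add: LS_integrator_def mono_on_def)
  ultimately have "distr M borel (step_integral X n t c) =
      normal_law (\<Sum>i=1..n. c i * (lam (t i) - lam (t (i - 1)))) (\<Sum>i=1..n. (c i)\<^sup>2 * (rho (t i) - rho (t (i - 1))))"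
    unfolding step_integral_def[abs_def] by (intro distr_sum_indep_normal_law) simp_all
  moreover have "mean (step_fun n t c) = (\<Sum>i=1..n. c i * (lam (t i) - lam (t (i - 1))))"
    unfolding LS_integral_def step_fun_LS_integral(2)[OF integrator_pos t]
      step_fun_LS_integral(2)[OF integrator_neg t] sum_subtractf[symmetric]
    by (intro sum.cong refl) (simp add: field_simps)
  moreover have "energy (step_fun n t c) = (\<Sum>i=1..n. (c i)\<^sup>2 * (rho (t i) - rho (t (i - 1))))"
    unfolding step_fun_square[OF t] by (rule step_fun_LS_integral(2)[OF integrator_rho t])
  ultimately show "distr M borel (step_integral X n t c) =
      normal_law (mean (step_fun n t c)) (energy (step_fun n t c))" by simp
qed

lemma step_integral_moments:
  assumes "is_partition a b n t"
  shows "step_integral X n t c \<in> L2 M"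
    and "expectation (\<lambda>\<omega>. (step_integral X n t c \<omega>)\<^sup>2) = energy (step_fun n t c) + (mean (step_fun n t c))\<^sup>2"
  by (rule normal_law_random_variable[OF step_integral_law[OF assms]], simp)+

text \<open>
  On step functions the Wiener integral is bounded from \<open>L\<^sup>2 \<nu>\<close> to \<open>L\<^sup>2 M\<close>; the difference of two
  step integrals is the integral of the difference, once both are written on a common partition.
\<close>

lemma step_integral_diff_bound:
  assumes t: "is_partition a b n t" and t': "is_partition a b n' t'"
  shows "expectation (\<lambda>\<omega>. (step_integral X n t c \<omega> - step_integral X n' t' c' \<omega>)\<^sup>2) \<le>
    bound_const * (\<integral>x. (step_fun n t c x - step_fun n' t' c' x)\<^sup>2 \<partial>\<nu>)"
proof -
  obtain m s d where s: "is_partition a b m s"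
    and "step_fun m s d = (\<lambda>x. 1 * step_fun n t c x + (-1) * step_fun n' t' c' x)"
      "step_integral X m s d = (\<lambda>\<omega>. 1 * step_integral X n t c \<omega> + (-1) * step_integral X n' t' c' \<omega>)"
    using step_fun_linear_combination[OF t t', of 1 c "-1" c' X] by blast
  then have d: "step_fun m s d = (\<lambda>x. step_fun n t c x - step_fun n' t' c' x)"
    "step_integral X m s d = (\<lambda>\<omega>. step_integral X n t c \<omega> - step_integral X n' t' c' \<omega>)"
    by simp_all
  show ?thesis
    using energy_mean_bound[OF step_fun_L2_nu[OF s], of d] step_integral_moments(2)[OF s, of d]
    unfolding d by (simp only:)
qed

lemma step_integrals_converge:
  assumes t: "\<And>k. is_partition a b (n k) (t k)" and lim: "tendsto_L2 \<nu> (\<lambda>k. step_fun (n k) (t k) (c k)) f"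
  obtains Y where "tendsto_L2 M (\<lambda>k. step_integral X (n k) (t k) (c k)) Y"
proof (rule L2_complete)
  let ?f = "\<lambda>k. step_fun (n k) (t k) (c k)" and ?Y = "\<lambda>k. step_integral X (n k) (t k) (c k)"
  show "?Y k \<in> L2 M" for k by (rule step_integral_moments(1)[OF t])
  show "\<exists>N. \<forall>i\<ge>N. \<forall>j\<ge>N. expectation (\<lambda>\<omega>. (?Y i \<omega> - ?Y j \<omega>)\<^sup>2) < e" if "0 < e" for e
  proof -
    let ?D = "\<lambda>k. \<integral>x. (?f k x - f x)\<^sup>2 \<partial>\<nu>"
    have L2: "?f k \<in> L2 \<nu>" "f \<in> L2 \<nu>" for k using lim by (auto simp: tendsto_L2_def)
    have "0 < e / (4 * bound_const)" using that bound_const_pos by simp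
    then have "\<forall>\<^sub>F k in sequentially. ?D k < e / (4 * bound_const)"
      using lim unfolding tendsto_L2_def by (intro order_tendstoD(2)[of _ 0]) auto
    then obtain N where N: "?D k < e / (4 * bound_const)" if "N \<le> k" for k
      unfolding eventually_sequentially by blast
    have "expectation (\<lambda>\<omega>. (?Y i \<omega> - ?Y j \<omega>)\<^sup>2) < e" if "N \<le> i" "N \<le> j" for i j
    proof -
      have "(\<integral>x. (?f i x - ?f j x)\<^sup>2 \<partial>\<nu>) \<le> 2 * ?D i + 2 * (\<integral>x. (f x - ?f j x)\<^sup>2 \<partial>\<nu>)"
        by (rule L2_dist_triangle[OF L2(1) L2(2) L2(1)])
      also have "\<dots> = 2 * ?D i + 2 * ?D j" by (simp only: power2_commute)
      also have "\<dots> < e / bound_const" using N[OF that(1)] N[OF that(2)] by simp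
      finally have "bound_const * (\<integral>x. (?f i x - ?f j x)\<^sup>2 \<partial>\<nu>) < e"
        using bound_const_pos by (simp add: pos_less_divide_eq mult.commute)
      with step_integral_diff_bound[OF t t] show ?thesis by (rule le_less_trans)
    qed
    then show ?thesis by blast
  qed
qed (rule that)

lemma step_integral_limits_agree:
  assumes t: "\<And>k. is_partition a b (n k) (t k)" and lim: "tendsto_L2 \<nu> (\<lambda>k. step_fun (n k) (t k) (c k)) f"
    and Y: "tendsto_L2 M (\<lambda>k. step_integral X (n k) (t k) (c k)) Y"
    and t': "\<And>k. is_partition a b (n' k) (t' k)" and lim': "tendsto_L2 \<nu> (\<lambda>k. step_fun (n' k) (t' k) (c' k)) f"
  shows "tendsto_L2 M (\<lambda>k. step_integral X (n' k) (t' k) (c' k)) Y"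
proof (rule tendsto_L2_perturb[OF Y])
  show "step_integral X (n' k) (t' k) (c' k) \<in> L2 M" for k by (rule step_integral_moments(1)[OF t'])
  have "(\<lambda>k. bound_const * (\<integral>x. (step_fun (n' k) (t' k) (c' k) x - step_fun (n k) (t k) (c k) x)\<^sup>2 \<partial>\<nu>))
      \<longlonglongrightarrow> bound_const * 0"
    by (intro tendsto_mult tendsto_const tendsto_L2_dist[OF lim lim'])
  then have null: "(\<lambda>k. bound_const * (\<integral>x. (step_fun (n' k) (t' k) (c' k) x - step_fun (n k) (t k) (c k) x)\<^sup>2 \<partial>\<nu>))
      \<longlonglongrightarrow> 0" by simp
  show "(\<lambda>k. expectation (\<lambda>\<omega>. (step_integral X (n' k) (t' k) (c' k) \<omega> - step_integral X (n k) (t k) (c k) \<omega>)\<^sup>2))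
      \<longlonglongrightarrow> 0"
    by (rule tendsto_sandwich[OF _ _ tendsto_const null])
      (intro always_eventually allI integral_nonneg_AE AE_I2 zero_le_power2 step_integral_diff_bound t t')+
qed

lemma step_sequence_exists:
  assumes "f \<in> L2 \<nu>"
  obtains n t c where "\<And>k. is_partition a b (n k) (t k)" "tendsto_L2 \<nu> (\<lambda>k. step_fun (n k) (t k) (c k)) f"
  using L2_step_approximable[OF integrator_nu, folded nu_eq_rho, OF assms]
  unfolding step_approximable_def nu_eq_rho[symmetric] by blast

text \<open>
  A common limit exists, so the choice operator in the definition of the Wiener integral picks a
  function with the required property. One approximating sequence produces the limit, and every
  other one has the same limit because \<open>I\<close> is bounded on differences of step functions.
\<close>

lemma wiener_integral_characterization:
  assumes f: "f \<in> L2 \<nu>"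
  shows "I f \<in> L2 M"
    and "(\<And>k. is_partition a b (n k) (t k)) \<Longrightarrow> tendsto_L2 \<nu> (\<lambda>k. step_fun (n k) (t k) (c k)) f \<Longrightarrow>
      tendsto_L2 M (\<lambda>k. step_integral X (n k) (t k) (c k)) (I f)"
proof -
  let ?P = "\<lambda>Y. Y \<in> L2 M \<and> (\<forall>n t c. (\<forall>k. is_partition a b (n k) (t k)) \<and>
    tendsto_L2 \<nu> (\<lambda>k. step_fun (n k) (t k) (c k)) f \<longrightarrow>
    tendsto_L2 M (\<lambda>k. step_integral X (n k) (t k) (c k)) Y)"
  obtain n0 t0 c0 where t0: "\<And>k. is_partition a b (n0 k) (t0 k)"
    and lim0: "tendsto_L2 \<nu> (\<lambda>k. step_fun (n0 k) (t0 k) (c0 k)) f"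
    using step_sequence_exists[OF f] by blast
  obtain Y where Y: "tendsto_L2 M (\<lambda>k. step_integral X (n0 k) (t0 k) (c0 k)) Y"
    by (rule step_integrals_converge[OF t0 lim0])
  have "?P Y"
    using step_integral_limits_agree[OF t0 lim0 Y] Y by (auto simp: tendsto_L2_def[of M _ Y])
  then have P: "?P (I f)" unfolding wiener_integral_def by (rule someI[where P = ?P])
  then show "I f \<in> L2 M" by simp
  show "tendsto_L2 M (\<lambda>k. step_integral X (n k) (t k) (c k)) (I f)"
    if "\<And>k. is_partition a b (n k) (t k)" "tendsto_L2 \<nu> (\<lambda>k. step_fun (n k) (t k) (c k)) f"
    using P that by blast
qed

lemma wiener_integral_cong_AE:
  assumes f: "f \<in> L2 \<nu>" and g: "g \<in> L2 \<nu>" and eq: "AE x in \<nu>. f x = g x"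
  shows "AE \<omega> in M. I f \<omega> = I g \<omega>"
proof -
  obtain n t c where t: "\<And>k. is_partition a b (n k) (t k)"
    and lim: "tendsto_L2 \<nu> (\<lambda>k. step_fun (n k) (t k) (c k)) f"
    using step_sequence_exists[OF f] by blast
  show ?thesis
    by (rule tendsto_L2_unique[OF wiener_integral_characterization(2)[OF f t lim]
          wiener_integral_characterization(2)[OF g t tendsto_L2_cong_AE[OF lim eq g]]])
qed

lemma wiener_integral_linear_combination:
  assumes f: "f \<in> L2 \<nu>" and g: "g \<in> L2 \<nu>"
  shows "AE \<omega> in M. I (\<lambda>x. \<alpha> * f x + \<beta> * g x) \<omega> = \<alpha> * I f \<omega> + \<beta> * I g \<omega>"
proof -
  obtain n t c where t: "\<And>k. is_partition a b (n k) (t k)"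
    and lim: "tendsto_L2 \<nu> (\<lambda>k. step_fun (n k) (t k) (c k)) f"
    using step_sequence_exists[OF f] by blast
  obtain n' t' c' where t': "\<And>k. is_partition a b (n' k) (t' k)"
    and lim': "tendsto_L2 \<nu> (\<lambda>k. step_fun (n' k) (t' k) (c' k)) g"
    using step_sequence_exists[OF g] by blast
  have "\<forall>k. \<exists>m s d. is_partition a b m s \<and>
      step_fun m s d = (\<lambda>x. \<alpha> * step_fun (n k) (t k) (c k) x + \<beta> * step_fun (n' k) (t' k) (c' k) x) \<and>
      step_integral X m s d = (\<lambda>\<omega>. \<alpha> * step_integral X (n k) (t k) (c k) \<omega> + \<beta> * step_integral X (n' k) (t' k) (c' k) \<omega>)"
    using step_fun_linear_combination[OF t t'] by blast
  then have "\<exists>m s d. \<forall>k. is_partition a b (m k) (s k) \<and>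
      step_fun (m k) (s k) (d k) = (\<lambda>x. \<alpha> * step_fun (n k) (t k) (c k) x + \<beta> * step_fun (n' k) (t' k) (c' k) x) \<and>
      step_integral X (m k) (s k) (d k) =
        (\<lambda>\<omega>. \<alpha> * step_integral X (n k) (t k) (c k) \<omega> + \<beta> * step_integral X (n' k) (t' k) (c' k) \<omega>)"
    by (simp only: choice_iff)
  then obtain m s d where s: "\<And>k. is_partition a b (m k) (s k)"
    and d: "\<And>k. step_fun (m k) (s k) (d k) =
        (\<lambda>x. \<alpha> * step_fun (n k) (t k) (c k) x + \<beta> * step_fun (n' k) (t' k) (c' k) x)"
      "\<And>k. step_integral X (m k) (s k) (d k) =
        (\<lambda>\<omega>. \<alpha> * step_integral X (n k) (t k) (c k) \<omega> + \<beta> * step_integral X (n' k) (t' k) (c' k) \<omega>)"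
    by blast
  have "tendsto_L2 \<nu> (\<lambda>k. step_fun (m k) (s k) (d k)) (\<lambda>x. \<alpha> * f x + \<beta> * g x)"
    unfolding d by (rule tendsto_L2_linear_combination[OF lim lim'])
  from wiener_integral_characterization(2)[OF L2_linear_combination(1)[OF f g] s this]
  have "tendsto_L2 M (\<lambda>k \<omega>. \<alpha> * step_integral X (n k) (t k) (c k) \<omega> + \<beta> * step_integral X (n' k) (t' k) (c' k) \<omega>)
      (I (\<lambda>x. \<alpha> * f x + \<beta> * g x))"
    unfolding d .
  moreover have "tendsto_L2 M (\<lambda>k \<omega>. \<alpha> * step_integral X (n k) (t k) (c k) \<omega> + \<beta> * step_integral X (n' k) (t' k) (c' k) \<omega>)
      (\<lambda>\<omega>. \<alpha> * I f \<omega> + \<beta> * I g \<omega>)"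
    by (rule tendsto_L2_linear_combination[OF wiener_integral_characterization(2)[OF f t lim]
          wiener_integral_characterization(2)[OF g t' lim']])
  ultimately show ?thesis by (rule tendsto_L2_unique)
qed

lemma wiener_integral_law:
  assumes f: "f \<in> L2 \<nu>"
  shows "distr M borel (I f) = normal_law (mean f) (energy f)"
proof -
  obtain n t c where t: "\<And>k. is_partition a b (n k) (t k)"
    and lim: "tendsto_L2 \<nu> (\<lambda>k. step_fun (n k) (t k) (c k)) f"
    using step_sequence_exists[OF f] by blast
  show ?thesis
    by (rule tendsto_L2_normal_law[OF wiener_integral_characterization(2)[OF f t lim]
          step_integral_law(2)[OF t] _ mean_tendsto[OF lim] energy_tendsto[OF lim]]) simp
qed

lemma wiener_integral_moments:
  assumes f: "f \<in> L2 \<nu>"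
  shows "expectation (I f) = mean f" "expectation (\<lambda>\<omega>. (I f \<omega>)\<^sup>2) = energy f + (mean f)\<^sup>2"
proof -
  have "I f \<in> borel_measurable M" using wiener_integral_characterization(1)[OF f] by (simp add: L2_def)
  from normal_law_random_variable[OF this wiener_integral_law[OF f]]
  show "expectation (I f) = mean f" "expectation (\<lambda>\<omega>. (I f \<omega>)\<^sup>2) = energy f + (mean f)\<^sup>2" by simp_all
qed

text \<open>
  By linearity of \<open>I\<close> the second moment of \<open>I f + I g\<close> is that of \<open>I (f + g)\<close>, so the mixed moment
  follows from the second moments by polarization.
\<close>

lemma wiener_integral_product:
  assumes f: "f \<in> L2 \<nu>" and g: "g \<in> L2 \<nu>"
  shows "expectation (\<lambda>\<omega>. I f \<omega> * I g \<omega>) = (\<integral>x. f x * g x \<partial>LS_measure a b rho) + mean f * mean g"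
proof -
  have expand: "(\<integral>x. (u x + v x)\<^sup>2 \<partial>N) = (\<integral>x. (u x)\<^sup>2 \<partial>N) + 2 * (\<integral>x. u x * v x \<partial>N) + (\<integral>x. (v x)\<^sup>2 \<partial>N)"
    if "u \<in> L2 N" "v \<in> L2 N" for u v :: "'z \<Rightarrow> real" and N
  proof -
    have "(\<integral>x. (u x + v x)\<^sup>2 \<partial>N) = (\<integral>x. (u x)\<^sup>2 + 2 * (u x * v x) + (v x)\<^sup>2 \<partial>N)"
      by (intro Bochner_Integration.integral_cong refl) (simp add: power2_eq_square algebra_simps)
    also have "\<dots> = (\<integral>x. (u x)\<^sup>2 \<partial>N) + 2 * (\<integral>x. u x * v x \<partial>N) + (\<integral>x. (v x)\<^sup>2 \<partial>N)"
      using that L2_integrable_mult[OF that] by (simp add: L2_def)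
    finally show ?thesis .
  qed
  note I_L2 = wiener_integral_characterization(1)
  have sum_L2: "(\<lambda>x. f x + g x) \<in> L2 \<nu>" using L2_linear_combination(1)[OF f g, of 1 1] by simp
  have mean_sum: "mean (\<lambda>x. f x + g x) = mean f + mean g"
    using mean_linear_combination[OF f g, of 1 1] by simp
  have meas: "I h \<in> borel_measurable M" if "h \<in> L2 \<nu>" for h
    using I_L2[OF that] by (simp add: L2_def)
  have "AE \<omega> in M. (I f \<omega> + I g \<omega>)\<^sup>2 = (I (\<lambda>x. f x + g x) \<omega>)\<^sup>2"
    using wiener_integral_linear_combination[OF f g, of 1 1] by eventually_elim simp
  then have "expectation (\<lambda>\<omega>. (I f \<omega> + I g \<omega>)\<^sup>2) = expectation (\<lambda>\<omega>. (I (\<lambda>x. f x + g x) \<omega>)\<^sup>2)"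
    using meas[OF f] meas[OF g] meas[OF sum_L2] by (intro integral_cong_AE) auto
  also have "\<dots> = energy (\<lambda>x. f x + g x) + (mean f + mean g)\<^sup>2"
    unfolding wiener_integral_moments(2)[OF sum_L2] mean_sum ..
  finally show ?thesis
    unfolding expand[OF I_L2[OF f] I_L2[OF g]] expand[OF L2_rho(1)[OF f] L2_rho(1)[OF g]]
      wiener_integral_moments(2)[OF f] wiener_integral_moments(2)[OF g]
    by (simp add: power2_eq_square algebra_simps)
qed

end

theorem theorem2p3:
  fixes M :: "'w measure" and X :: "real \<Rightarrow> 'w \<Rightarrow> real"
    and a b :: real and lam rho :: "real \<Rightarrow> real"
  assumes "prob_space M"
    and "standing_assumptions a b lam rho"
    and "yeh_process M X a b lam rho"
  shows "let V = L2_lam_rho a b lam rho; I = wiener_integral M X a b lam rho in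
    (\<forall>f\<in>V. I f \<in> L2 M) \<and>
    (\<forall>f\<in>V. \<forall>g\<in>V. (AE x in measure_lam_rho a b lam rho. f x = g x) \<longrightarrow>
       (AE \<omega> in M. I f \<omega> = I g \<omega>)) \<and>
    (\<forall>f\<in>V. \<forall>g\<in>V. \<forall>\<alpha> \<beta> :: real.
       AE \<omega> in M. I (\<lambda>x. \<alpha> * f x + \<beta> * g x) \<omega> = \<alpha> * I f \<omega> + \<beta> * I g \<omega>) \<and>
    (\<forall>f\<in>V. (\<integral>\<omega>. I f \<omega> \<partial>M) = LS_integral a b lam f) \<and>
    (\<forall>f\<in>V. \<forall>g\<in>V. (\<integral>\<omega>. I f \<omega> * I g \<omega> \<partial>M) =
       (\<integral>x. f x * g x \<partial>LS_measure a b rho) + LS_integral a b lam f * LS_integral a b lam g) \<and>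
    (\<forall>f\<in>V. (\<integral>\<omega>. (I f \<omega>)\<^sup>2 \<partial>M) =
       (\<integral>x. (f x)\<^sup>2 \<partial>LS_measure a b rho) + (LS_integral a b lam f)\<^sup>2) \<and>
    (\<forall>f\<in>V. distr M borel (I f) =
       normal_law (LS_integral a b lam f) (\<integral>x. (f x)\<^sup>2 \<partial>LS_measure a b rho))"
proof -
  interpret yeh_process_on_interval M X a b lam rho
    using assms by (intro yeh_process_on_interval.intro yeh_process_on_interval_axioms.intro)
  show ?thesis
    unfolding Let_def L2_lam_rho_eq_L2_nu
    using wiener_integral_characterization(1) wiener_integral_cong_AE wiener_integral_linear_combination
      wiener_integral_moments wiener_integral_product wiener_integral_law
    by (intro conjI ballI allI impI) simp_all
qed

end
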